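(* Satisfiability over $\mathbb{R}$ is undecidable for the fragment $\mathrm{UF}^{\mathrm{unary}}+\mathrm{RDL}$ even when restricted to formulas containing a single uninterpreted unary predicate symbol. That is, no algorithm decides, for a formula of this restricted fragment, whether it has a model over $\mathbb{R}$.
   Context: Formulas are first-order formulas (with arbitrary quantification) over variables ranging over $\mathbb{R}$. The atoms are: $P(x)$ with $P$ an uninterpreted unary predicate; order constraints $x\bowtie y$; difference constraints $x-y\bowtie c$. Here $x,y$ are variables, $c\in\mathbb{Z}$, and $\bowtie\in\{<,\le,=,\ge,>\}$. Atoms "$x\in\mathbb{Z}$" are not allowed. Arithmetic is interpreted as usual on $\mathbb{R}$, free variables are assigned reals, and each uninterpreted predicate is interpreted as an arbitrary subset of $\mathbb{R}$. The formulas of this fragment form $\mathrm{UF}^{\mathrm{unary}}+\mathrm{RDL}$. *)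

theory Defs
  imports Complex_Main "HOL-Library.Nat_Bijection"
begin

section \<open>Formulas with unary uninterpreted predicates and real difference constraints\<close>

text \<open>Variables and predicate symbols are both named by natural numbers.\<close>

datatype cmp = LT | LE | EQ | GE | GT

datatype fm =
    Pred nat nat            (* Pred p x:   P_p(x) *)
  | Order cmp nat nat       (* Order r x y:  x r y *)
  | Diff cmp nat nat int    (* Diff r x y c:  x - y r c *)
  | Neg fm
  | Conj fm fm
  | Disj fm fm
  | Impl fm fm
  | Iff fm fm
  | Exists nat fm
  | Forall nat fm

primrec cmp_holds :: "cmp \<Rightarrow> real \<Rightarrow> real \<Rightarrow> bool" where
  "cmp_holds LT a b \<longleftrightarrow> a < b"
| "cmp_holds LE a b \<longleftrightarrow> a \<le> b"
| "cmp_holds EQ a b \<longleftrightarrow> a = b"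
| "cmp_holds GE a b \<longleftrightarrow> a \<ge> b"
| "cmp_holds GT a b \<longleftrightarrow> a > b"

primrec holds :: "(nat \<Rightarrow> real set) \<Rightarrow> (nat \<Rightarrow> real) \<Rightarrow> fm \<Rightarrow> bool" where
  "holds I v (Pred p x) \<longleftrightarrow> v x \<in> I p"
| "holds I v (Order r x y) \<longleftrightarrow> cmp_holds r (v x) (v y)"
| "holds I v (Diff r x y c) \<longleftrightarrow> cmp_holds r (v x - v y) (real_of_int c)"
| "holds I v (Neg A) \<longleftrightarrow> \<not> holds I v A"
| "holds I v (Conj A B) \<longleftrightarrow> holds I v A \<and> holds I v B"
| "holds I v (Disj A B) \<longleftrightarrow> holds I v A \<or> holds I v B"
| "holds I v (Impl A B) \<longleftrightarrow> (holds I v A \<longrightarrow> holds I v B)"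
| "holds I v (Iff A B) \<longleftrightarrow> (holds I v A \<longleftrightarrow> holds I v B)"
| "holds I v (Exists x A) \<longleftrightarrow> (\<exists>a. holds I (v(x := a)) A)"
| "holds I v (Forall x A) \<longleftrightarrow> (\<forall>a. holds I (v(x := a)) A)"

definition satisfiable :: "fm \<Rightarrow> bool" where
  "satisfiable A \<longleftrightarrow> (\<exists>I v. holds I v A)"

primrec pred_symbols :: "fm \<Rightarrow> nat set" where
  "pred_symbols (Pred p x) = {p}"
| "pred_symbols (Order r x y) = {}"
| "pred_symbols (Diff r x y c) = {}"
| "pred_symbols (Neg A) = pred_symbols A"
| "pred_symbols (Conj A B) = pred_symbols A \<union> pred_symbols B"
| "pred_symbols (Disj A B) = pred_symbols A \<union> pred_symbols B"
| "pred_symbols (Impl A B) = pred_symbols A \<union> pred_symbols B"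
| "pred_symbols (Iff A B) = pred_symbols A \<union> pred_symbols B"
| "pred_symbols (Exists x A) = pred_symbols A"
| "pred_symbols (Forall x A) = pred_symbols A"


section \<open>Goedel numbering of formulas\<close>

primrec cmp_code :: "cmp \<Rightarrow> nat" where
  "cmp_code LT = 0"
| "cmp_code LE = 1"
| "cmp_code EQ = 2"
| "cmp_code GE = 3"
| "cmp_code GT = 4"

primrec fm_code :: "fm \<Rightarrow> nat" where
  "fm_code (Pred p x) = prod_encode (0, prod_encode (p, x))"
| "fm_code (Order r x y) =
     prod_encode (1, prod_encode (cmp_code r, prod_encode (x, y)))"
| "fm_code (Diff r x y c) =
     prod_encode (2, prod_encode (cmp_code r, prod_encode (x, prod_encode (y, int_encode c))))"
| "fm_code (Neg A) = prod_encode (3, fm_code A)"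
| "fm_code (Conj A B) = prod_encode (4, prod_encode (fm_code A, fm_code B))"
| "fm_code (Disj A B) = prod_encode (5, prod_encode (fm_code A, fm_code B))"
| "fm_code (Impl A B) = prod_encode (6, prod_encode (fm_code A, fm_code B))"
| "fm_code (Iff A B) = prod_encode (7, prod_encode (fm_code A, fm_code B))"
| "fm_code (Exists x A) = prod_encode (8, prod_encode (x, fm_code A))"
| "fm_code (Forall x A) = prod_encode (9, prod_encode (x, fm_code A))"

lemma cmp_code_inject [simp]: "cmp_code r = cmp_code s \<longleftrightarrow> r = s"
  by (cases r; cases s) simp_all

lemma fm_code_inject: "fm_code A = fm_code B \<Longrightarrow> A = B"
proof (induction A arbitrary: B)
  case (Pred p x) then show ?case by (cases B) simp_all
next
  case (Order r x y) then show ?case by (cases B) simp_all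
next
  case (Diff r x y c) then show ?case by (cases B) (simp_all add: inj_eq [OF inj_int_encode])
next
  case (Neg A) then show ?case by (cases B) simp_all
next
  case (Conj A1 A2) then show ?case by (cases B) simp_all
next
  case (Disj A1 A2) then show ?case by (cases B) simp_all
next
  case (Impl A1 A2) then show ?case by (cases B) simp_all
next
  case (Iff A1 A2) then show ?case by (cases B) simp_all
next
  case (Exists x A) then show ?case by (cases B) simp_all
next
  case (Forall x A) then show ?case by (cases B) simp_all
qed

lemma inj_fm_code: "inj fm_code"
  by (rule injI) (rule fm_code_inject)


section \<open>Partial recursive functions\<close>

text \<open>
  Arities are not recorded in the terms: they are determined by the length of the argument list,
  which every rule below fixes for the subterms. A term denotes a partial function, undefinedness
  being the absence of a result. Primitive recursion is on the first argument, and
  \<open>Mu f\<close> searches for the least first argument at which \<open>f\<close> vanishes, \<open>f\<close> having to be defined at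
  all smaller ones.
\<close>

datatype recf = Zero | Succ | Proj nat | Comp recf "recf list" | PrimRec recf recf | Mu recf

inductive computes :: "recf \<Rightarrow> nat list \<Rightarrow> nat \<Rightarrow> bool" where
  zero: "computes Zero xs 0"
| succ: "computes Succ [x] (Suc x)"
| proj: "i < length xs \<Longrightarrow> computes (Proj i) xs (xs ! i)"
| comp: "\<lbrakk>length ys = length gs; \<forall>i<length gs. computes (gs ! i) xs (ys ! i); computes f ys z\<rbrakk>
    \<Longrightarrow> computes (Comp f gs) xs z"
| prim_0: "computes f xs z \<Longrightarrow> computes (PrimRec f g) (0 # xs) z"
| prim_Suc: "\<lbrakk>computes (PrimRec f g) (n # xs) y; computes g (n # y # xs) z\<rbrakk>
    \<Longrightarrow> computes (PrimRec f g) (Suc n # xs) z"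
| mu: "\<lbrakk>computes f (n # xs) 0; \<forall>m<n. \<exists>k. computes f (m # xs) (Suc k)\<rbrakk>
    \<Longrightarrow> computes (Mu f) xs n"

lemma computes_functional: "computes f xs y \<Longrightarrow> computes f xs z \<Longrightarrow> y = z"
proof (induction arbitrary: z rule: computes.induct)
  case (zero xs)
  then show ?case by cases simp
next
  case (succ x)
  then show ?case by cases simp
next
  case (proj i xs)
  from proj(2) show ?case by cases simp
next
  case (comp ys gs xs f w)
  from comp.prems obtain ys' where ys': "length ys' = length gs"
      "\<forall>i<length gs. computes (gs ! i) xs (ys' ! i)" "computes f ys' z"
    by cases auto
  have "ys = ys'"
    by (rule nth_equalityI) (use comp ys' in auto)
  then show ?case using comp.IH ys' by auto
next
  case (prim_0 f xs w g)
  from prim_0.prems show ?case by cases (use prim_0.IH in auto)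
next
  case (prim_Suc f g n xs y w)
  from prim_Suc.prems show ?case by cases (use prim_Suc.IH in auto)
next
  case (mu f n xs)
  from mu.prems have z: "computes f (z # xs) 0" "\<forall>m<z. \<exists>k. computes f (m # xs) (Suc k)"
    by (cases; auto)+
  have "\<not> z < n" using mu.IH z by fastforce
  moreover have "\<not> n < z" using mu.IH z by fastforce
  ultimately show ?case by simp
qed

text \<open>
  An algorithm deciding \<open>Q\<close> for the instances in \<open>A\<close> receives the code of an instance and must
  halt with the correct answer 1 or 0; nothing is required on inputs that are not codes of
  elements of \<open>A\<close>.
\<close>

definition decidable_on :: "('a \<Rightarrow> nat) \<Rightarrow> 'a set \<Rightarrow> ('a \<Rightarrow> bool) \<Rightarrow> bool" where
  "decidable_on code A Q \<longleftrightarrow>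
     (\<exists>f. \<forall>a\<in>A. computes f [code a] (if Q a then 1 else 0))"

end

theory Submission
  imports Defs
begin

text \<open>
  A counter machine run is laid out along the real line, one configuration per block of \<open>L\<close> units, a
  register being the number of points of the predicate in one of the unit intervals of the block.
  Since difference constraints can compare a point \<open>y\<close> with \<open>y + L\<close>, a formula can demand that each
  block is followed by its successor configuration, the points being copied one by one.

  Undecidability then follows by diagonalisation, without a universal machine. Every unary
  recursive \<open>f\<close> has a formula \<open>A\<close> such that prefixing \<open>A\<close> with \<open>m\<close> copies of a fixed quantifier
  prefix, which loads \<open>m\<close> into the input register, is satisfiable if \<open>f m = 0\<close> and unsatisfiable if
  \<open>f m = 1\<close>. Apply this to the function that sends \<open>m\<close> to the verdict of a decision procedure on the
  formula whose code arises from \<open>m\<close> by adding the prefix \<open>m\<close> times: at the code of \<open>A\<close> the verdict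
  is wrong.
\<close>

section \<open>Computable arithmetic\<close>

lemma computes_Comp1:
  "computes g xs y \<Longrightarrow> computes f [y] z \<Longrightarrow> computes (Comp f [g]) xs z"
  by (rule computes.comp[where ys = "[y]"]) auto

lemma computes_Comp2:
  "computes g xs y \<Longrightarrow> computes h xs y' \<Longrightarrow> computes f [y, y'] z \<Longrightarrow> computes (Comp f [g, h]) xs z"
  by (rule computes.comp[where ys = "[y, y']"]) (auto simp: less_Suc_eq)

lemma computes_Proj: "i < length xs \<Longrightarrow> y = xs ! i \<Longrightarrow> computes (Proj i) xs y"
  by (auto intro: computes.proj)

definition computable :: "(nat \<Rightarrow> nat) \<Rightarrow> bool" where
  "computable f \<longleftrightarrow> (\<exists>r. \<forall>x. computes r [x] (f x))"

lemma computable_const: "computable (\<lambda>x. k)"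
proof (induction k)
  case 0
  show ?case unfolding computable_def by (blast intro: computes.zero)
next
  case (Suc k)
  then show ?case unfolding computable_def by (blast intro: computes.succ computes_Comp1)
qed

lemma computable_id: "computable (\<lambda>x. x)"
  unfolding computable_def by (rule exI[where x = "Proj 0"]) (auto intro: computes_Proj)

definition add_recf :: recf where
  "add_recf = PrimRec (Proj 0) (Comp Succ [Proj 1])"

lemma computes_add: "computes add_recf [m, n] (m + n)"
proof (induction m)
  case 0
  show ?case unfolding add_recf_def by (rule computes.prim_0) (simp add: computes_Proj)
next
  case (Suc m)
  have "computes (Comp Succ [Proj 1]) [m, m + n, n] (Suc m + n)"
    by (rule computes_Comp1[where y = "m + n"]) (auto intro: computes_Proj computes.succ)
  with Suc show ?case unfolding add_recf_def by (rule computes.prim_Suc)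
qed

definition triangle_recf :: recf where
  "triangle_recf = PrimRec Zero (Comp add_recf [Proj 1, Comp Succ [Proj 0]])"

lemma computes_triangle: "computes triangle_recf [n] (triangle n)"
proof (induction n)
  case 0
  show ?case unfolding triangle_recf_def by (rule computes.prim_0) (simp add: computes.zero)
next
  case (Suc n)
  have "computes (Comp Succ [Proj 0]) [n, triangle n] (Suc n)"
    by (rule computes_Comp1[where y = n]) (auto intro: computes_Proj computes.succ)
  then have "computes (Comp add_recf [Proj 1, Comp Succ [Proj 0]]) [n, triangle n] (triangle n + Suc n)"
    by (rule computes_Comp2[rotated]) (use computes_add[of "triangle n" "Suc n"] in \<open>auto intro: computes_Proj\<close>)
  with Suc show ?case unfolding triangle_recf_def by (auto intro: computes.prim_Suc)
qed

lemma ex_prod_encode_recf: "\<exists>r. \<forall>m n. computes r [m, n] (prod_encode (m, n))"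
proof (intro exI allI)
  fix m n
  have "computes (Comp triangle_recf [add_recf]) [m, n] (triangle (m + n))"
    by (rule computes_Comp1[OF computes_add computes_triangle])
  then show "computes (Comp add_recf [Comp triangle_recf [add_recf], Proj 0]) [m, n] (prod_encode (m, n))"
    by (rule computes_Comp2) (use computes_add[of "triangle (m + n)" m] in \<open>auto intro: computes_Proj simp: prod_encode_def\<close>)
qed

lemma computable_prod_encode:
  assumes "computable f" "computable g"
  shows "computable (\<lambda>x. prod_encode (f x, g x))"
proof -
  obtain r where "\<And>m n. computes r [m, n] (prod_encode (m, n))"
    using ex_prod_encode_recf by blast
  moreover obtain rf rg where "\<And>x. computes rf [x] (f x)" "\<And>x. computes rg [x] (g x)"
    using assms unfolding computable_def by blast
  ultimately have "\<And>x. computes (Comp r [rf, rg]) [x] (prod_encode (f x, g x))"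
    by (blast intro: computes_Comp2)
  then show ?thesis unfolding computable_def by blast
qed

text \<open>The diagonal argument iterates a map on codes as many times as the code itself
  indicates.\<close>

lemma computable_diagonal_iterate:
  assumes "computable G"
  shows "computable (\<lambda>x. (G ^^ x) x)"
proof -
  obtain r where r: "\<And>x. computes r [x] (G x)"
    using assms unfolding computable_def by blast
  let ?it = "PrimRec (Proj 0) (Comp r [Proj 1])"
  have "computes ?it [n, a] ((G ^^ n) a)" for n a
  proof (induction n)
    case 0
    show ?case by (rule computes.prim_0) (simp add: computes_Proj)
  next
    case (Suc n)
    have "computes (Comp r [Proj 1]) [n, (G ^^ n) a, a] (G ((G ^^ n) a))"
      by (rule computes_Comp1[OF _ r]) (simp add: computes_Proj)
    with Suc show ?case by (auto intro: computes.prim_Suc)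
  qed
  then have "computes (Comp ?it [Proj 0, Proj 0]) [x] ((G ^^ x) x)" for x
    by (auto intro: computes_Comp2 computes_Proj)
  then show ?thesis unfolding computable_def by blast
qed

section \<open>Loop programs\<close>

text \<open>\<open>LOOP\<close> is a while loop: the register is tested and decremented before each
  pass, and the body may refill it, so unbounded search can be expressed.\<close>

datatype com = INC nat | CLR nat | SEQ com com | LOOP nat com

inductive exec :: "com \<Rightarrow> (nat \<Rightarrow> nat) \<Rightarrow> (nat \<Rightarrow> nat) \<Rightarrow> bool" where
  inc: "exec (INC r) s (s(r := Suc (s r)))"
| clr: "exec (CLR r) s (s(r := 0))"
| seq: "exec c s t \<Longrightarrow> exec d t u \<Longrightarrow> exec (SEQ c d) s u"
| loop_0: "s r = 0 \<Longrightarrow> exec (LOOP r c) s s"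
| loop_Suc: "s r = Suc n \<Longrightarrow> exec c (s(r := n)) t \<Longrightarrow> exec (LOOP r c) t u \<Longrightarrow> exec (LOOP r c) s u"

lemma exec_eq: "exec c s t \<Longrightarrow> t = u \<Longrightarrow> exec c s u"
  by simp

lemma exec_move:
  assumes "a \<noteq> b"
  shows "exec (LOOP a (INC b)) s (s(a := 0, b := s b + s a))"
proof (induction "s a" arbitrary: s)
  case 0
  have "s(a := 0, b := s b + s a) = s" using 0 by (auto simp: fun_eq_iff)
  then show ?case using loop_0[of s a] 0 by metis
next
  case (Suc n)
  let ?t = "s(a := n, b := Suc (s b))"
  have "exec (INC b) (s(a := n)) ?t"
    using inc[of b "s(a := n)"] assms by simp
  moreover have "exec (LOOP a (INC b)) ?t (?t(a := 0, b := ?t b + ?t a))"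
    using Suc(1)[of ?t] assms by simp
  ultimately have "exec (LOOP a (INC b)) s (?t(a := 0, b := ?t b + ?t a))"
    using Suc(2) by (metis loop_Suc)
  then show ?case by (rule exec_eq) (use assms Suc(2) in \<open>auto simp: fun_eq_iff\<close>)
qed

lemma exec_move2:
  assumes "a \<noteq> b" "a \<noteq> d" "b \<noteq> d"
  shows "exec (LOOP a (SEQ (INC b) (INC d))) s (s(a := 0, b := s b + s a, d := s d + s a))"
proof (induction "s a" arbitrary: s)
  case 0
  have "s(a := 0, b := s b + s a, d := s d + s a) = s" using 0 by (auto simp: fun_eq_iff)
  then show ?case using loop_0[of s a] 0 by metis
next
  case (Suc n)
  let ?t = "s(a := n, b := Suc (s b), d := Suc (s d))"
  have "exec (SEQ (INC b) (INC d)) (s(a := n)) ?t"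
    using seq[OF inc[of b "s(a := n)"] inc[of d]] assms by simp
  moreover have "exec (LOOP a (SEQ (INC b) (INC d))) ?t (?t(a := 0, b := ?t b + ?t a, d := ?t d + ?t a))"
    using Suc(1)[of ?t] assms by simp
  ultimately have "exec (LOOP a (SEQ (INC b) (INC d))) s (?t(a := 0, b := ?t b + ?t a, d := ?t d + ?t a))"
    using Suc(2) by (metis loop_Suc)
  then show ?case by (rule exec_eq) (use assms Suc(2) in \<open>auto simp: fun_eq_iff\<close>)
qed

text \<open>Reading a register by a loop empties it, so its content is parked in \<open>b\<close>
  and then returned to \<open>a\<close> and \<open>d\<close> together.\<close>

definition copy :: "nat \<Rightarrow> nat \<Rightarrow> nat \<Rightarrow> com" where
  "copy a d b = SEQ (LOOP a (INC b)) (LOOP b (SEQ (INC a) (INC d)))"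

lemma exec_copy:
  assumes "a \<noteq> b" "a \<noteq> d" "b \<noteq> d" "s b = 0" "s d = 0" "t = s(d := s a)"
  shows "exec (copy a d b) s t"
proof -
  let ?u = "s(a := 0, b := s b + s a)"
  have "exec (LOOP b (SEQ (INC a) (INC d))) ?u (?u(b := 0, a := ?u a + ?u b, d := ?u d + ?u b))"
    by (rule exec_move2) (use assms in auto)
  then have "exec (LOOP b (SEQ (INC a) (INC d))) ?u t"
    by (rule exec_eq) (use assms in \<open>auto simp: fun_eq_iff\<close>)
  with exec_move[OF assms(1)] show ?thesis unfolding copy_def by (rule seq)
qed

text \<open>No command does nothing, so the range is closed at both ends and never empty, which
  gives the induction a base program.\<close>

lemma ex_clear_range: "\<exists>c. \<forall>s. exec c s (\<lambda>r. if b \<le> r \<and> r \<le> b + j then 0 else s r)"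
proof (induction j)
  case 0
  have "exec (CLR b) s (\<lambda>r. if b \<le> r \<and> r \<le> b + 0 then 0 else s r)" for s
    by (rule exec_eq[OF clr]) auto
  then show ?case by blast
next
  case (Suc j)
  then obtain c where c: "\<And>s. exec c s (\<lambda>r. if b \<le> r \<and> r \<le> b + j then 0 else s r)" by blast
  have "exec (SEQ c (CLR (b + Suc j))) s (\<lambda>r. if b \<le> r \<and> r \<le> b + Suc j then 0 else s r)" for s
    by (rule exec_eq[OF seq[OF c clr]]) auto
  then show ?case by blast
qed

section \<open>Compiling recursive functions into loop programs\<close>

text \<open>Registers from \<open>b\<close> upwards are scratch space: zero before and after the execution.\<close>

definition implements :: "recf \<Rightarrow> nat list \<Rightarrow> nat \<Rightarrow> nat \<Rightarrow> com \<Rightarrow> bool" where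
  "implements f A d b c \<longleftrightarrow>
     (\<forall>s y. s d = 0 \<longrightarrow> (\<forall>r\<ge>b. s r = 0) \<longrightarrow> computes f (map s A) y \<longrightarrow> exec c s (s(d := y)))"

lemma implementsI:
  assumes "\<And>s y. s d = 0 \<Longrightarrow> (\<And>r. r \<ge> b \<Longrightarrow> s r = 0) \<Longrightarrow> computes f (map s A) y \<Longrightarrow> exec c s (s(d := y))"
  shows "implements f A d b c"
  using assms unfolding implements_def by blast

lemma implementsD:
  assumes "implements f A d b c" "s d = 0" "\<And>r. r \<ge> b \<Longrightarrow> s r = 0" "map s A = xs"
    "computes f xs y" "t = s(d := y)"
  shows "exec c s t"
  using assms unfolding implements_def by blast

text \<open>The values of \<open>gs\<close> are collected in the \<open>length gs\<close> registers
  from \<open>b\<close> on, above which the scratch space of all subprograms begins;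
  \<open>f\<close> then takes these registers as its arguments.\<close>

lemma ex_implements_Comp:
  assumes F: "\<And>A d b. \<forall>a\<in>set A. a < b \<Longrightarrow> d < b \<Longrightarrow> d \<notin> set A \<Longrightarrow> \<exists>c. implements f A d b c"
    and G: "\<And>g A d b. g \<in> set gs \<Longrightarrow> \<forall>a\<in>set A. a < b \<Longrightarrow> d < b \<Longrightarrow> d \<notin> set A \<Longrightarrow> \<exists>c. implements g A d b c"
    and A: "\<forall>a\<in>set A. a < b" "d < b" "d \<notin> set A"
  shows "\<exists>c. implements (Comp f gs) A d b c"
proof -
  let ?k = "length gs"
  have "\<exists>c. implements (gs ! i) A (b + i) (b + ?k) c" if "i < ?k" for i
    by (rule G) (use that A in fastforce)+
  then have "\<forall>i. \<exists>c. i < ?k \<longrightarrow> implements (gs ! i) A (b + i) (b + ?k) c" by blast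
  then obtain C where C: "\<And>i. i < ?k \<Longrightarrow> implements (gs ! i) A (b + i) (b + ?k) (C i)"
    unfolding choice_iff by blast
  define fill where "fill j ys s = (\<lambda>r. if b \<le> r \<and> r < b + j then ys ! (r - b) else s r)"
    for j and ys :: "nat list" and s
  have "\<exists>c. \<forall>s ys. (\<forall>r\<ge>b. s r = 0) \<longrightarrow> (\<forall>i<?k. computes (gs ! i) (map s A) (ys ! i)) \<longrightarrow>
      exec c s (fill j ys s)" if "j \<le> ?k" for j
    using that
  proof (induction j)
    case 0
    \<comment> \<open>\<open>CLR b\<close> stands in for an empty program, as register
      \<open>b\<close> is already zero.\<close>
    have "exec (CLR b) s (fill 0 ys s)" if "\<forall>r\<ge>b. s r = 0" for s ys
      by (rule exec_eq[OF clr]) (use that in \<open>auto simp: fill_def\<close>)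
    then show ?case by blast
  next
    case (Suc j)
    then have "j \<le> ?k" by simp
    from Suc.IH[OF this] obtain c where
      c: "\<forall>s ys. (\<forall>r\<ge>b. s r = 0) \<longrightarrow> (\<forall>i<?k. computes (gs ! i) (map s A) (ys ! i)) \<longrightarrow>
        exec c s (fill j ys s)" ..
    have "exec (SEQ c (C j)) s (fill (Suc j) ys s)"
      if s: "\<forall>r\<ge>b. s r = 0" and ys: "\<forall>i<?k. computes (gs ! i) (map s A) (ys ! i)" for s ys
    proof (rule seq)
      show "exec c s (fill j ys s)" using c s ys by simp
      show "exec (C j) (fill j ys s) (fill (Suc j) ys s)"
      proof (rule implementsD[OF C])
        show "j < ?k" using Suc by simp
        show "map (fill j ys s) A = map s A" using A by (auto simp: fill_def)
        show "computes (gs ! j) (map s A) (ys ! j)" using ys Suc by simp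
      qed (use s Suc in \<open>auto simp: fill_def fun_eq_iff\<close>)
    qed
    then show ?case by blast
  qed
  from this[OF order_refl] obtain c1 where
    c1: "\<forall>s ys. (\<forall>r\<ge>b. s r = 0) \<longrightarrow> (\<forall>i<?k. computes (gs ! i) (map s A) (ys ! i)) \<longrightarrow>
      exec c1 s (fill ?k ys s)" ..
  have "\<exists>c. implements f [b..<b + ?k] d (b + ?k) c"
    by (rule F) (use A in auto)
  then obtain c2 where c2: "implements f [b..<b + ?k] d (b + ?k) c2" by blast
  obtain c3 where c3: "\<And>s. exec c3 s (\<lambda>r. if b \<le> r \<and> r \<le> b + ?k then 0 else s r)"
    using ex_clear_range by blast
  have "implements (Comp f gs) A d b (SEQ c1 (SEQ c2 c3))"
  proof (rule implementsI)
    fix s y assume s: "s d = 0" "\<And>r. r \<ge> b \<Longrightarrow> s r = 0" and "computes (Comp f gs) (map s A) y"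
    from this(3) obtain ys where ys: "length ys = ?k" "\<forall>i<?k. computes (gs ! i) (map s A) (ys ! i)"
      "computes f ys y" by cases auto
    have "exec c2 (fill ?k ys s) ((fill ?k ys s)(d := y))"
    proof (rule implementsD[OF c2])
      show "map (fill ?k ys s) [b..<b + ?k] = ys"
        using ys by (auto simp: fill_def intro!: nth_equalityI)
    qed (use s ys A in \<open>auto simp: fill_def\<close>)
    moreover have "exec c3 ((fill ?k ys s)(d := y)) (s(d := y))"
      by (rule exec_eq[OF c3]) (use s A in \<open>auto simp: fill_def fun_eq_iff\<close>)
    moreover have "exec c1 s (fill ?k ys s)" using c1 s ys by simp
    ultimately show "exec (SEQ c1 (SEQ c2 c3)) s (s(d := y))" by (blast intro: seq)
  qed
  then show ?thesis by blast
qed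

text \<open>Register \<open>b\<close> holds the recursion counter, \<open>b + 1\<close> the current
  value, \<open>b + 2\<close> the number of passes left, and \<open>b + 3\<close> receives each new
  value of \<open>g\<close>.\<close>

lemma ex_implements_PrimRec:
  assumes F: "\<And>A d b. \<forall>a\<in>set A. a < b \<Longrightarrow> d < b \<Longrightarrow> d \<notin> set A \<Longrightarrow> \<exists>c. implements f A d b c"
    and G: "\<And>A d b. \<forall>a\<in>set A. a < b \<Longrightarrow> d < b \<Longrightarrow> d \<notin> set A \<Longrightarrow> \<exists>c. implements g A d b c"
    and A: "\<forall>a\<in>set (a # A). a < b" "d < b" "d \<notin> set (a # A)"
  shows "\<exists>c. implements (PrimRec f g) (a # A) d b c"
proof -
  have "\<exists>c. implements f A (b + 1) (b + 4) c" by (rule F) (use A in fastforce)+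
  then obtain cf where cf: "implements f A (b + 1) (b + 4) cf" by blast
  have "\<exists>c. implements g (b # (b + 1) # A) (b + 3) (b + 4) c" by (rule G) (use A in fastforce)+
  then obtain cg where cg: "implements g (b # (b + 1) # A) (b + 3) (b + 4) cg" by blast
  define body where "body = SEQ cg (SEQ (CLR (b + 1)) (SEQ (LOOP (b + 3) (INC (b + 1))) (INC b)))"
  define loop where "loop = LOOP (b + 2) body"
  define c where "c = SEQ (copy a (b + 2) (b + 3)) (SEQ cf (SEQ loop (SEQ (LOOP (b + 1) (INC d)) (CLR b))))"
  have "implements (PrimRec f g) (a # A) d b c"
  proof (rule implementsI)
    fix s y assume s: "s d = 0" "\<And>r. r \<ge> b \<Longrightarrow> s r = 0" and "computes (PrimRec f g) (map s (a # A)) y"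
    define xs where "xs = map s A"
    define n where "n = s a"
    have comp: "computes (PrimRec f g) (n # xs) y"
      using \<open>computes _ _ y\<close> by (simp add: n_def xs_def)
    define S where "S i l y = s(b := i, b + 1 := y, b + 2 := l)" for i l y
    have xs: "map (S i l y) A = xs" for i l y
      unfolding xs_def by (rule map_cong[OF refl]) (use A in \<open>auto simp: S_def\<close>)
    have body: "exec body (S i l y) (S (Suc i) l z)" if "computes g (i # y # xs) z" for i l y z
    proof -
      let ?s1 = "(S i l y)(b + 3 := z)"
      let ?s2 = "?s1(b + 1 := 0)"
      let ?s3 = "?s2(b + 3 := 0, b + 1 := ?s2 (b + 1) + ?s2 (b + 3))"
      have "exec cg (S i l y) ?s1"
        by (rule implementsD[OF cg _ _ _ that]) (use s xs in \<open>auto simp: S_def\<close>)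
      moreover have "exec (CLR (b + 1)) ?s1 ?s2" by (rule clr)
      moreover have "exec (LOOP (b + 3) (INC (b + 1))) ?s2 ?s3"
        by (rule exec_move) simp
      moreover have "exec (INC b) ?s3 (S (Suc i) l z)"
        by (rule exec_eq[OF inc]) (use s in \<open>auto simp: S_def fun_eq_iff\<close>)
      ultimately show ?thesis unfolding body_def by (blast intro: seq)
    qed
    \<comment> \<open>A derivation for \<open>PrimRec\<close> is taken apart from \<open>n\<close>
      downwards while the loop counts up from 0. The induction therefore takes a loop execution that
      starts in the middle and extends it backwards to the beginning.\<close>
    have unwind: "\<exists>y0. computes f xs y0 \<and> (\<forall>u l. exec loop (S n l y) u \<longrightarrow> exec loop (S 0 (n + l) y0) u)"
      if "computes (PrimRec f g) (n # xs) y" for n y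
      using that
    proof (induction n arbitrary: y)
      case 0
      then have "computes f xs y" by cases auto
      then show ?case by auto
    next
      case (Suc n)
      from Suc.prems obtain y' where y': "computes (PrimRec f g) (n # xs) y'" "computes g (n # y' # xs) y"
        by cases auto
      obtain y0 where y0: "computes f xs y0" "\<And>u l. exec loop (S n l y') u \<Longrightarrow> exec loop (S 0 (n + l) y0) u"
        using Suc.IH[OF y'(1)] by blast
      have "exec loop (S 0 (Suc n + l) y0) u" if "exec loop (S (Suc n) l y) u" for u l
      proof -
        have eq: "(S n (Suc l) y')(b + 2 := l) = S n l y'" "S n (Suc l) y' (b + 2) = Suc l"
          by (auto simp: S_def)
        have "exec loop (S n (Suc l) y') u"
          unfolding loop_def
          by (rule loop_Suc[where n = l and t = "S (Suc n) l y"])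
            (use eq body[OF y'(2)] that in \<open>auto simp: loop_def\<close>)
        from y0(2)[OF this] show ?thesis by simp
      qed
      with y0(1) show ?case by blast
    qed
    obtain y0 where y0: "computes f xs y0" "\<And>u. exec loop (S n 0 y) u \<Longrightarrow> exec loop (S 0 n y0) u"
      using unwind[OF comp] by (metis add_0_right)
    have 1: "exec (copy a (b + 2) (b + 3)) s (S 0 n 0)"
      by (rule exec_copy) (use A s in \<open>auto simp: S_def n_def fun_eq_iff\<close>)
    have 2: "exec cf (S 0 n 0) (S 0 n y0)"
      by (rule implementsD[OF cf _ _ xs y0(1)]) (use s in \<open>auto simp: S_def fun_eq_iff\<close>)
    have 3: "exec loop (S 0 n y0) (S n 0 y)"
      by (rule y0(2)) (auto simp: loop_def S_def intro: loop_0)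
    have 4: "exec (LOOP (b + 1) (INC d)) (S n 0 y) ((S n 0 y)(b + 1 := 0, d := S n 0 y d + S n 0 y (b + 1)))"
      by (rule exec_move) (use A in simp)
    have 5: "exec (CLR b) ((S n 0 y)(b + 1 := 0, d := S n 0 y d + S n 0 y (b + 1))) (s(d := y))"
      by (rule exec_eq[OF clr]) (use A s in \<open>auto simp: S_def fun_eq_iff\<close>)
    show "exec c s (s(d := y))"
      unfolding c_def using 1 2 3 4 5 by (blast intro: seq)
  qed
  then show ?thesis by blast
qed

text \<open>Register \<open>b\<close> holds the candidate and \<open>b + 1\<close> the value of
  \<open>f\<close> there, so the loop ends at the first candidate with value 0.\<close>

lemma ex_implements_Mu:
  assumes F: "\<And>A d b. \<forall>a\<in>set A. a < b \<Longrightarrow> d < b \<Longrightarrow> d \<notin> set A \<Longrightarrow> \<exists>c. implements f A d b c"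
    and A: "\<forall>a\<in>set A. a < b" "d < b" "d \<notin> set A"
  shows "\<exists>c. implements (Mu f) A d b c"
proof -
  have "\<exists>c. implements f (b # A) (b + 1) (b + 2) c" by (rule F) (use A in fastforce)+
  then obtain cf where cf: "implements f (b # A) (b + 1) (b + 2) cf" by blast
  \<comment> \<open>\<open>LOOP\<close> has taken only one unit off the old value, so the rest must
    be cleared before \<open>f\<close> is recomputed.\<close>
  define body where "body = SEQ (CLR (b + 1)) (SEQ (INC b) cf)"
  define loop where "loop = LOOP (b + 1) body"
  have "implements (Mu f) A d b (SEQ cf (SEQ loop (LOOP b (INC d))))"
  proof (rule implementsI)
    fix s n assume s: "s d = 0" "\<And>r. r \<ge> b \<Longrightarrow> s r = 0" and "computes (Mu f) (map s A) n"
    define xs where "xs = map s A"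
    have n: "computes f (n # xs) 0" "\<And>m. m < n \<Longrightarrow> \<exists>k. computes f (m # xs) (Suc k)"
      using \<open>computes _ _ n\<close> unfolding xs_def by (cases; auto)+
    define S where "S m v = s(b := m, b + 1 := v)" for m v
    have xs: "map (S m v) A = xs" for m v
      unfolding xs_def by (rule map_cong[OF refl]) (use A in \<open>auto simp: S_def\<close>)
    have cf': "exec cf (S m 0) (S m v)" if "computes f (m # xs) v" for m v
      by (rule implementsD[OF cf _ _ _ that]) (use s xs in \<open>auto simp: S_def\<close>)
    have body: "exec body (S m k) (S (Suc m) v)" if "computes f (Suc m # xs) v" for m k v
    proof -
      have "exec (CLR (b + 1)) (S m k) (S m 0)"
        by (rule exec_eq[OF clr]) (auto simp: S_def)
      moreover have "exec (INC b) (S m 0) (S (Suc m) 0)"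
        by (rule exec_eq[OF inc]) (auto simp: S_def)
      ultimately show ?thesis unfolding body_def using cf'[OF that] by (blast intro: seq)
    qed
    \<comment> \<open>Backward induction from the least zero \<open>n\<close>, where the loop
      stops.\<close>
    have loop: "exec loop (S m v) (S n 0)" if "m \<le> n" "computes f (m # xs) v" for m v
      using that
    proof (induction m arbitrary: v rule: inc_induct)
      case base
      then have "v = 0" using n(1) computes_functional by blast
      then show ?case unfolding loop_def by (auto simp: S_def intro: loop_0)
    next
      case (step m)
      obtain k where k: "computes f (m # xs) (Suc k)" using n(2) step by blast
      then have v: "v = Suc k" using step.prems computes_functional by blast
      obtain w where w: "computes f (Suc m # xs) w"
        using n step by (cases "Suc m = n") (auto, metis Suc_lessI)
      have "(S m v)(b + 1 := k) = S m k" "S m v (b + 1) = Suc k" using v by (auto simp: S_def)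
      then show ?case
        unfolding loop_def using body[OF w, of k] step.IH[OF w]
        by (metis loop_Suc loop_def)
    qed
    obtain v where v: "computes f (0 # xs) v" using n by (cases n) auto
    have "exec (LOOP b (INC d)) (S n 0) (s(d := n))"
      by (rule exec_eq[OF exec_move]) (use A s in \<open>auto simp: S_def fun_eq_iff\<close>)
    moreover have "S 0 0 = s" using s by (auto simp: S_def)
    ultimately show "exec (SEQ cf (SEQ loop (LOOP b (INC d)))) s (s(d := n))"
      using cf'[OF v] loop[OF _ v] by (metis le0 seq)
  qed
  then show ?thesis by blast
qed

lemma ex_implements:
  "\<forall>a\<in>set A. a < b \<Longrightarrow> d < b \<Longrightarrow> d \<notin> set A \<Longrightarrow> \<exists>c. implements f A d b c"
proof (induction f arbitrary: A d b)
  case Zero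
  have "implements Zero A d b (CLR d)"
    by (rule implementsI) (auto elim: computes.cases intro: clr)
  then show ?case by blast
next
  case Succ
  have "implements Succ A d b (SEQ (copy (hd A) d b) (INC d))"
  proof (rule implementsI)
    fix s y assume s: "s d = 0" "\<And>r. r \<ge> b \<Longrightarrow> s r = 0" and "computes Succ (map s A) y"
    from this(3) obtain a where a: "A = [a]" "y = Suc (s a)" by cases auto
    have "exec (copy a d b) s (s(d := s a))" by (rule exec_copy) (use a s Succ in auto)
    moreover have "exec (INC d) (s(d := s a)) (s(d := y))"
      by (rule exec_eq[OF inc]) (use a in auto)
    ultimately show "exec (SEQ (copy (hd A) d b) (INC d)) s (s(d := y))"
      using a by (auto intro: seq)
  qed
  then show ?case by blast
next
  case (Proj i)
  have "implements (Proj i) A d b (copy (A ! i) d b)"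
  proof (rule implementsI)
    fix s y assume s: "s d = 0" "\<And>r. r \<ge> b \<Longrightarrow> s r = 0" and "computes (Proj i) (map s A) y"
    from this(3) have i: "i < length A" "y = s (A ! i)" by (cases; auto)+
    then have "A ! i \<in> set A" by simp
    with i s Proj show "exec (copy (A ! i) d b) s (s(d := y))"
      by (intro exec_copy) auto
  qed
  then show ?case by blast
next
  case (Comp f gs)
  show ?case by (rule ex_implements_Comp) (use Comp in blast)+
next
  case (PrimRec f g)
  show ?case
  proof (cases A)
    case Nil
    \<comment> \<open>\<open>PrimRec\<close> has no result on an empty argument list, so any program
      will do.\<close>
    have "implements (PrimRec f g) [] d b (CLR 0)"
      by (rule implementsI) (auto elim: computes.cases)
    then show ?thesis using Nil by blast
  next
    case (Cons a A')
    show ?thesis unfolding Cons by (rule ex_implements_PrimRec) (use PrimRec Cons in blast)+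
  qed
next
  case (Mu f)
  show ?case by (rule ex_implements_Mu) (use Mu in blast)+
qed

section \<open>Counter machines\<close>

datatype instr = Incr nat nat | Jzdec nat nat nat

primrec effect :: "instr \<Rightarrow> (nat \<Rightarrow> nat) \<Rightarrow> nat \<times> (nat \<Rightarrow> nat)" where
  "effect (Incr r k) s = (k, s(r := Suc (s r)))"
| "effect (Jzdec r k0 k1) s = (if s r = 0 then (k0, s) else (k1, s(r := s r - 1)))"

definition step :: "(nat \<times> instr) set \<Rightarrow> nat \<times> (nat \<Rightarrow> nat) \<Rightarrow> nat \<times> (nat \<Rightarrow> nat) \<Rightarrow> bool" where
  "step p C D \<longleftrightarrow> (\<exists>i. (fst C, i) \<in> p \<and> D = effect i (snd C))"

section \<open>Translating loop programs into counter machine code\<close>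

primrec com_size :: "com \<Rightarrow> nat" where
  "com_size (INC r) = 1"
| "com_size (CLR r) = 1"
| "com_size (SEQ c d) = com_size c + com_size d"
| "com_size (LOOP r c) = Suc (com_size c)"

text \<open>The code of a program is entered at label \<open>q\<close> and left by a jump to label \<open>k\<close>.\<close>

primrec flat :: "com \<Rightarrow> nat \<Rightarrow> nat \<Rightarrow> (nat \<times> instr) set" where
  "flat (INC r) q k = {(q, Incr r k)}"
| "flat (CLR r) q k = {(q, Jzdec r k q)}"
| "flat (SEQ c d) q k = flat c q (q + com_size c) \<union> flat d (q + com_size c) k"
| "flat (LOOP r c) q k = insert (q, Jzdec r k (Suc q)) (flat c (Suc q) q)"

lemma finite_flat: "finite (flat c q k)"
  by (induction c arbitrary: q k) auto

lemma flat_label: "(l, i) \<in> flat c q k \<Longrightarrow> q \<le> l \<and> l < q + com_size c"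
  by (induction c arbitrary: q k) fastforce+

text \<open>By \<open>flat_label\<close> the parts of a program occupy disjoint label ranges. The
  construction of a model relies on this, as all instructions at a label must be obeyed at
  once.\<close>

lemma flat_deterministic: "(l, i) \<in> flat c q k \<Longrightarrow> (l, j) \<in> flat c q k \<Longrightarrow> i = j"
proof (induction c arbitrary: q k)
  case (SEQ c d)
  then show ?case by (fastforce dest: flat_label)
next
  case (LOOP r c)
  then show ?case by (fastforce dest: flat_label)
qed auto

lemma stepI: "(q, i) \<in> p \<Longrightarrow> D = effect i s \<Longrightarrow> step p (q, s) D"
  unfolding step_def by auto

lemma exec_steps: "exec c s t \<Longrightarrow> flat c q k \<subseteq> p \<Longrightarrow> (step p)\<^sup>*\<^sup>* (q, s) (k, t)"
proof (induction arbitrary: q k rule: exec.induct)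
  case (inc r s)
  show ?case
    by (rule r_into_rtranclp, rule stepI[where i = "Incr r k"]) (use inc in auto)
next
  case (clr r s)
  show ?case
  \<comment> \<open>\<open>CLR\<close> became an instruction that jumps back to itself until the
    register is empty, so a single command takes \<open>s r + 1\<close> steps.\<close>
  proof (induction "s r" arbitrary: s)
    case 0
    then have "s(r := 0) = s" by auto
    show ?case
      by (rule r_into_rtranclp, rule stepI[where i = "Jzdec r k q"]) (use 0 clr \<open>s(r := 0) = s\<close> in auto)
  next
    case (Suc n)
    have "step p (q, s) (q, s(r := n))"
      by (rule stepI[where i = "Jzdec r k q"]) (use clr Suc(2)[symmetric] in auto)
    moreover have "(step p)\<^sup>*\<^sup>* (q, s(r := n)) (k, s(r := 0))"
      using Suc(1)[of "s(r := n)"] by simp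
    ultimately show ?case by (rule converse_rtranclp_into_rtranclp)
  qed
next
  case (seq c s t d u)
  have "(step p)\<^sup>*\<^sup>* (q, s) (q + com_size c, t)" "(step p)\<^sup>*\<^sup>* (q + com_size c, t) (k, u)"
    using seq by auto
  then show ?case by (rule rtranclp_trans)
next
  case (loop_0 s r c)
  show ?case
    by (rule r_into_rtranclp, rule stepI[where i = "Jzdec r k (Suc q)"]) (use loop_0 in auto)
next
  case (loop_Suc s r n c t u)
  have "step p (q, s) (Suc q, s(r := n))"
    by (rule stepI[where i = "Jzdec r k (Suc q)"]) (use loop_Suc in auto)
  moreover have "(step p)\<^sup>*\<^sup>* (Suc q, s(r := n)) (q, t)" "(step p)\<^sup>*\<^sup>* (q, t) (k, u)"
    using loop_Suc.IH loop_Suc.prems by (auto simp del: fun_upd_apply)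
  ultimately show ?case by (meson converse_rtranclp_into_rtranclp rtranclp_trans)
qed

section \<open>Describing machine runs\<close>

text \<open>
  A configuration is laid out in a block of \<open>L\<close> unit intervals whose left end \<open>x\<close> is variable 4. The
  interval \<open>(x, x + 1)\<close> is contained in the predicate and marks the beginning of a block, the point
  \<open>x + q\<close> belongs to the predicate iff the machine is in state \<open>q\<close>, and register \<open>r\<close> is the number of
  elements of the predicate in \<open>(x + 1 + r, x + 2 + r)\<close>. A point is carried over to the next block
  by adding \<open>L\<close>.
\<close>

definition flag_fm :: "int \<Rightarrow> fm" where
  "flag_fm j = Exists 7 (Conj (Diff EQ 7 4 j) (Pred 0 7))"

definition start_fm :: "int \<Rightarrow> fm" where
  "start_fm j = Forall 5 (Impl (Conj (Diff GT 5 4 j) (Diff LT 5 4 (j + 1))) (Pred 0 5))"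

definition slot_fm :: "nat \<Rightarrow> nat \<Rightarrow> fm" where
  "slot_fm y r = Conj (Diff GT y 4 (int r + 1)) (Diff LT y 4 (int r + 2))"

definition shifted_fm :: "nat \<Rightarrow> fm" where
  "shifted_fm L = Exists 7 (Conj (Diff EQ 7 5 (int L)) (Pred 0 7))"

definition empty_fm :: "nat \<Rightarrow> fm" where
  "empty_fm r = Forall 5 (Impl (slot_fm 5 r) (Neg (Pred 0 5)))"

definition keep_fm :: "nat \<Rightarrow> nat \<Rightarrow> fm" where
  "keep_fm L r = Forall 5 (Impl (slot_fm 5 r) (Iff (shifted_fm L) (Pred 0 5)))"

text \<open>The cardinality grows by one without any counting: variable 6 names an absent point of
  the slot, and the next block is compared with the slot enriched by it.\<close>

definition inc_fm :: "nat \<Rightarrow> nat \<Rightarrow> fm" where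
  "inc_fm L r = Exists 6 (Conj (slot_fm 6 r) (Conj (Neg (Pred 0 6))
     (Forall 5 (Impl (slot_fm 5 r) (Iff (shifted_fm L) (Disj (Pred 0 5) (Order EQ 5 6)))))))"

definition dec_fm :: "nat \<Rightarrow> nat \<Rightarrow> fm" where
  "dec_fm L r = Exists 6 (Conj (slot_fm 6 r) (Conj (Pred 0 6)
     (Forall 5 (Impl (slot_fm 5 r) (Iff (shifted_fm L) (Conj (Pred 0 5) (Neg (Order EQ 5 6))))))))"

primrec conj_list :: "fm list \<Rightarrow> fm" where
  "conj_list [] = Order EQ 4 4"
| "conj_list (A # As) = Conj A (conj_list As)"

text \<open>\<open>rs\<close> lists the registers changed by the instruction, whose new content is
  described separately.\<close>

definition next_fm :: "nat \<Rightarrow> nat \<Rightarrow> nat \<Rightarrow> nat list \<Rightarrow> fm" where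
  "next_fm L R k rs = Conj (start_fm (int L)) (Conj (flag_fm (int L + int k))
     (conj_list (map (keep_fm L) (filter (\<lambda>i. i \<notin> set rs) [0..<R]))))"

primrec instr_fm :: "nat \<Rightarrow> nat \<Rightarrow> instr \<Rightarrow> fm" where
  "instr_fm L R (Incr r k) = Conj (next_fm L R k [r]) (inc_fm L r)"
| "instr_fm L R (Jzdec r k0 k1) =
     Disj (Conj (next_fm L R k0 []) (empty_fm r)) (Conj (next_fm L R k1 [r]) (dec_fm L r))"

definition at_label_fm :: "nat \<Rightarrow> fm \<Rightarrow> fm" where
  "at_label_fm q A = Forall 4 (Impl (Conj (start_fm 0) (flag_fm (int q))) A)"

section \<open>The formulas as conditions on a set of reals\<close>

definition start :: "real set \<Rightarrow> real \<Rightarrow> bool" where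
  "start P x \<longleftrightarrow> (\<forall>y. x < y \<longrightarrow> y < x + 1 \<longrightarrow> y \<in> P)"

definition slot :: "real \<Rightarrow> nat \<Rightarrow> real set" where
  "slot x r = {x + (real r + 1)<..<x + (real r + 2)}"

definition carries :: "real set \<Rightarrow> nat \<Rightarrow> real \<Rightarrow> nat \<Rightarrow> real set \<Rightarrow> bool" where
  "carries P L x r Q \<longleftrightarrow> (\<forall>y\<in>slot x r. y + real L \<in> P \<longleftrightarrow> y \<in> Q)"

definition next_block :: "real set \<Rightarrow> nat \<Rightarrow> nat \<Rightarrow> real \<Rightarrow> nat \<Rightarrow> nat list \<Rightarrow> bool" where
  "next_block P L R x k rs \<longleftrightarrow> start P (x + real L) \<and> x + real L + real k \<in> P \<and>
     (\<forall>r<R. r \<notin> set rs \<longrightarrow> carries P L x r P)"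

primrec obeys :: "real set \<Rightarrow> nat \<Rightarrow> nat \<Rightarrow> real \<Rightarrow> instr \<Rightarrow> bool" where
  "obeys P L R x (Incr r k) \<longleftrightarrow> next_block P L R x k [r] \<and>
     (\<exists>w\<in>slot x r. w \<notin> P \<and> carries P L x r (insert w P))"
| "obeys P L R x (Jzdec r k0 k1) \<longleftrightarrow>
     next_block P L R x k0 [] \<and> slot x r \<inter> P = {} \<or>
     next_block P L R x k1 [r] \<and> (\<exists>w\<in>slot x r. w \<in> P \<and> carries P L x r (P - {w}))"

lemma holds_flag: "holds I v (flag_fm j) \<longleftrightarrow> v 4 + real_of_int j \<in> I 0"
proof -
  have "a - v 4 = real_of_int j \<longleftrightarrow> a = v 4 + real_of_int j" for a by auto
  then show ?thesis by (simp add: flag_fm_def)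
qed

lemma holds_start: "holds I v (start_fm j) \<longleftrightarrow> start (I 0) (v 4 + real_of_int j)"
  by (auto simp: start_fm_def start_def algebra_simps)

lemma holds_slot: "holds I v (slot_fm y r) \<longleftrightarrow> v y \<in> slot (v 4) r"
  by (auto simp: slot_fm_def slot_def algebra_simps)

lemma holds_shifted: "holds I v (shifted_fm L) \<longleftrightarrow> v 5 + real L \<in> I 0"
proof -
  have "a - v 5 = real L \<longleftrightarrow> a = v 5 + real L" for a by auto
  then show ?thesis by (simp add: shifted_fm_def)
qed

lemma holds_empty: "holds I v (empty_fm r) \<longleftrightarrow> slot (v 4) r \<inter> I 0 = {}"
  by (auto simp: empty_fm_def holds_slot)

lemma holds_keep: "holds I v (keep_fm L r) \<longleftrightarrow> carries (I 0) L (v 4) r (I 0)"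
  by (auto simp: keep_fm_def holds_slot holds_shifted carries_def)

lemma holds_inc:
  "holds I v (inc_fm L r) \<longleftrightarrow> (\<exists>w\<in>slot (v 4) r. w \<notin> I 0 \<and> carries (I 0) L (v 4) r (insert w (I 0)))"
  by (auto simp: inc_fm_def holds_slot holds_shifted carries_def disj_commute)

lemma holds_dec:
  "holds I v (dec_fm L r) \<longleftrightarrow> (\<exists>w\<in>slot (v 4) r. w \<in> I 0 \<and> carries (I 0) L (v 4) r (I 0 - {w}))"
  by (auto simp: dec_fm_def holds_slot holds_shifted carries_def)

lemma holds_conj_list: "holds I v (conj_list As) \<longleftrightarrow> (\<forall>A\<in>set As. holds I v A)"
  by (induction As) auto

lemma holds_next: "holds I v (next_fm L R k rs) \<longleftrightarrow> next_block (I 0) L R (v 4) k rs"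
  by (auto simp: next_fm_def next_block_def holds_start holds_flag holds_keep holds_conj_list add.assoc)

lemma holds_instr: "holds I v (instr_fm L R i) \<longleftrightarrow> obeys (I 0) L R (v 4) i"
  by (cases i) (simp_all add: holds_next holds_inc holds_dec holds_empty)

lemma holds_at_label:
  "holds I v (at_label_fm q A) \<longleftrightarrow> (\<forall>x. start (I 0) x \<longrightarrow> x + real q \<in> I 0 \<longrightarrow> holds I (v(4 := x)) A)"
  by (auto simp: at_label_fm_def holds_start holds_flag)

lemmas fm_defs = flag_fm_def start_fm_def slot_fm_def shifted_fm_def empty_fm_def keep_fm_def
  inc_fm_def dec_fm_def next_fm_def at_label_fm_def

lemma pred_symbols_conj_list: "pred_symbols (conj_list As) = (\<Union>A\<in>set As. pred_symbols A)"
  by (induction As) auto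

lemma pred_symbols_instr: "pred_symbols (instr_fm L R i) = {0}"
  by (cases i) (auto simp: fm_defs pred_symbols_conj_list)

text \<open>Only the flag of the current label has to be present; further flags do no harm, since in
  a model every instruction whose flag is set is obeyed. Finiteness is stated because
  \<open>card\<close> is 0 on infinite sets.\<close>

definition encodes :: "real set \<Rightarrow> nat \<Rightarrow> real \<Rightarrow> nat \<times> (nat \<Rightarrow> nat) \<Rightarrow> bool" where
  "encodes P R x C \<longleftrightarrow> start P x \<and> x + real (fst C) \<in> P \<and>
     (\<forall>r<R. finite (P \<inter> slot x r) \<and> card (P \<inter> slot x r) = snd C r)"

lemma carries_image:
  assumes "carries P L x r Q"
  shows "P \<inter> slot (x + real L) r = (\<lambda>y. y + real L) ` (Q \<inter> slot x r)"
proof (intro equalityI subsetI)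
  fix y assume y: "y \<in> P \<inter> slot (x + real L) r"
  then have "y - real L \<in> slot x r" by (auto simp: slot_def)
  moreover from this have "y - real L + real L \<in> P \<longleftrightarrow> y - real L \<in> Q"
    using assms unfolding carries_def by blast
  ultimately have "y - real L \<in> Q \<inter> slot x r" using y by simp
  then show "y \<in> (\<lambda>y. y + real L) ` (Q \<inter> slot x r)" by (auto intro!: image_eqI[of _ _ "y - real L"])
next
  fix y assume "y \<in> (\<lambda>y. y + real L) ` (Q \<inter> slot x r)"
  then obtain z where z: "y = z + real L" "z \<in> Q" "z \<in> slot x r" by blast
  then have "y \<in> P" using assms unfolding carries_def by blast
  then show "y \<in> P \<inter> slot (x + real L) r" using z by (auto simp: slot_def)
qed

lemma card_carries:
  assumes "carries P L x r Q"
  shows "card (P \<inter> slot (x + real L) r) = card (Q \<inter> slot x r)"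
    "finite (P \<inter> slot (x + real L) r) \<longleftrightarrow> finite (Q \<inter> slot x r)"
  using carries_image[OF assms] by (simp_all add: card_image finite_image_iff)

lemma encodes_effect:
  assumes "encodes P R x (q, s)" "obeys P L R x i"
    and R: "case i of Incr r k \<Rightarrow> r < R | Jzdec r k0 k1 \<Rightarrow> r < R"
  shows "encodes P R (x + real L) (effect i s)"
proof -
  have s: "finite (P \<inter> slot x r)" "card (P \<inter> slot x r) = s r" if "r < R" for r
    using assms that by (auto simp: encodes_def)
  \<comment> \<open>Registers outside \<open>rs\<close> are carried with \<open>Q = P\<close>; for
    those in \<open>rs\<close> the set \<open>Q\<close> accounts for the point added or
    removed.\<close>
  have step: "encodes P R (x + real L) (k, t)"
    if "next_block P L R x k rs" "\<And>r. r < R \<Longrightarrow> r \<in> set rs \<Longrightarrow>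
        \<exists>Q. carries P L x r Q \<and> finite (Q \<inter> slot x r) \<and> card (Q \<inter> slot x r) = t r"
      "\<And>r. r \<notin> set rs \<Longrightarrow> t r = s r" for k t rs
  proof -
    have "\<exists>Q. carries P L x r Q \<and> finite (Q \<inter> slot x r) \<and> card (Q \<inter> slot x r) = t r" if "r < R" for r
      using that \<open>next_block P L R x k rs\<close> \<open>\<And>r. _ \<Longrightarrow> _ \<Longrightarrow> \<exists>Q. _ r Q\<close> \<open>\<And>r. _ \<Longrightarrow> t r = _\<close> s
      by (cases "r \<in> set rs") (auto simp: next_block_def)
    then have "finite (P \<inter> slot (x + real L) r) \<and> card (P \<inter> slot (x + real L) r) = t r" if "r < R" for r
      using that card_carries by metis
    then show ?thesis using \<open>next_block P L R x k rs\<close> by (simp add: encodes_def next_block_def)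
  qed
  show ?thesis
  proof (cases i)
    case (Incr r k)
    then obtain w where w: "w \<in> slot x r" "w \<notin> P" "carries P L x r (insert w P)"
      and n: "next_block P L R x k [r]" using assms by auto
    have r: "r < R" using R Incr by simp
    have "finite (insert w P \<inter> slot x r) \<and> card (insert w P \<inter> slot x r) = Suc (s r)"
      using w s[OF r] by simp
    with w(3) have "\<exists>Q. carries P L x r Q \<and> finite (Q \<inter> slot x r) \<and> card (Q \<inter> slot x r) = Suc (s r)" by blast
    then have "encodes P R (x + real L) (k, s(r := Suc (s r)))"
      by (intro step[OF n]) simp_all
    then show ?thesis using Incr by simp
  next
    case (Jzdec r k0 k1)
    have r: "r < R" using R Jzdec by simp
    consider "next_block P L R x k0 []" "slot x r \<inter> P = {}"
      | w where "next_block P L R x k1 [r]" "w \<in> slot x r" "w \<in> P" "carries P L x r (P - {w})"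
      using assms Jzdec by auto
    then show ?thesis
    proof cases
      case 1
      have "s r = 0" using s[OF r] 1 by (simp add: Int_commute)
      moreover have "encodes P R (x + real L) (k0, s)" by (rule step[OF 1(1)]) auto
      ultimately show ?thesis using Jzdec by simp
    next
      case 2
      have w: "(P - {w}) \<inter> slot x r = (P \<inter> slot x r) - {w}" "w \<in> P \<inter> slot x r" using 2 by auto
      then have "s r \<noteq> 0" using s[OF r] by (metis card_0_eq empty_iff)
      have "finite ((P - {w}) \<inter> slot x r) \<and> card ((P - {w}) \<inter> slot x r) = s r - 1"
        unfolding w(1) using w(2) s[OF r] by simp
      with 2(4) have "\<exists>Q. carries P L x r Q \<and> finite (Q \<inter> slot x r) \<and> card (Q \<inter> slot x r) = s r - 1" by blast
      then have "encodes P R (x + real L) (k1, s(r := s r - 1))"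
        by (intro step[OF 2(1)]) simp_all
      then show ?thesis using Jzdec \<open>s r \<noteq> 0\<close> by simp
    qed
  qed
qed

definition follows :: "real set \<Rightarrow> nat \<Rightarrow> nat \<Rightarrow> (nat \<times> instr) set \<Rightarrow> bool" where
  "follows P L R p \<longleftrightarrow> (\<forall>(q, i)\<in>p. \<forall>x. start P x \<longrightarrow> x + real q \<in> P \<longrightarrow> obeys P L R x i)"

definition registers_below :: "nat \<Rightarrow> (nat \<times> instr) set \<Rightarrow> bool" where
  "registers_below R p \<longleftrightarrow> (\<forall>(q, i)\<in>p. case i of Incr r k \<Rightarrow> r < R | Jzdec r k0 k1 \<Rightarrow> r < R)"

text \<open>Each machine step moves the encoding one block to the right, so a model contains every
  configuration reachable from an encoded one.\<close>

lemma follows_steps: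
  assumes "follows P L R p" "registers_below R p" "encodes P R x C" "(step p)\<^sup>*\<^sup>* C D"
  shows "\<exists>y. encodes P R y D"
  using assms(4)
proof (induction rule: rtranclp_induct)
  case base
  then show ?case using assms(3) by blast
next
  case (step D E)
  then obtain y i where y: "encodes P R y D" and i: "(fst D, i) \<in> p" "E = effect i (snd D)"
    unfolding step_def by blast
  have "obeys P L R y i" using y i assms(1) by (auto simp: follows_def encodes_def)
  moreover have "case i of Incr r k \<Rightarrow> r < R | Jzdec r k0 k1 \<Rightarrow> r < R"
    using i assms(2) by (fastforce simp: registers_below_def)
  ultimately have "encodes P R (y + real L) E"
    using encodes_effect[of P R y "fst D" "snd D"] y i by auto
  then show ?case by blast
qed

section \<open>Sets of reals tracing a given run\<close>

text \<open>
  The elements of register sets have fractional part in \<open>(1/2, 3/4]\<close>, so no unit interval that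
  meets a register slot is contained in the trace.
\<close>

definition mark :: "nat \<Rightarrow> real" where
  "mark e = 1 / 2 + 1 / (real e + 4)"

lemma mark_bounds: "1 / 2 < mark e" "mark e \<le> 3 / 4" "0 < mark e" "mark e < 1"
  by (auto simp: mark_def field_simps add_pos_nonneg)

lemma mark_eq_iff: "mark d = mark e \<longleftrightarrow> d = e"
  by (auto simp: mark_def)

text \<open>\<open>j\<close> is the integer offset in the block and \<open>t\<close> the fractional
  part. The points with \<open>t = 0\<close> are the label flags; otherwise offset 0 is the starting
  interval and offset \<open>j > 0\<close> the slot of register \<open>j - 1\<close>.\<close>

definition in_block :: "nat \<times> (nat \<Rightarrow> nat) \<Rightarrow> nat \<Rightarrow> real \<Rightarrow> bool" where
  "in_block C j t \<longleftrightarrow> (if t = 0 then j = fst C else j = 0 \<or> (\<exists>e<snd C (j - 1). t = mark e))"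

definition trace :: "nat \<Rightarrow> nat \<Rightarrow> (nat \<Rightarrow> nat \<times> (nat \<Rightarrow> nat)) \<Rightarrow> real set" where
  "trace L T C = {real (i * L + j) + t | i j t. i \<le> T \<and> j < L \<and> 0 \<le> t \<and> t < 1 \<and> in_block (C i) j t}"

lemma floor_decomposition_unique:
  fixes s t :: real
  assumes "real a + s = real b + t" "0 \<le> s" "s < 1" "0 \<le> t" "t < 1"
  shows "a = b" "s = t"
proof -
  have "real a < real (Suc b)" "real b < real (Suc a)" using assms by simp_all
  then show "a = b" by (simp only: of_nat_less_iff)
  with assms show "s = t" by simp
qed

lemma block_decomposition_unique:
  fixes i j L :: nat
  assumes "i * L + j = i' * L + j'" "j < L" "j' < L"
  shows "i = i'" "j = j'"
proof -
  have "(a * L + b) div L = a \<and> (a * L + b) mod L = b" if "b < L" for a b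
    using that by (cases "L = 0") (auto simp: div_mult_self3)
  with assms show "i = i'" "j = j'" by metis+
qed

lemma mem_trace:
  assumes "i \<le> T" "j < L" "0 \<le> t" "t < 1"
  shows "real (i * L + j) + t \<in> trace L T C \<longleftrightarrow> in_block (C i) j t"
proof
  assume "real (i * L + j) + t \<in> trace L T C"
  then obtain i' j' t' where *: "real (i * L + j) + t = real (i' * L + j') + t'"
    "j' < L" "0 \<le> t'" "t' < 1" "in_block (C i') j' t'" by (auto simp: trace_def simp del: of_nat_add of_nat_mult)
  have "i * L + j = i' * L + j'" "t = t'"
    by (rule floor_decomposition_unique[OF *(1)]; fact assms *)+
  with block_decomposition_unique[OF this(1)] * assms show "in_block (C i) j t" by auto
next
  assume "in_block (C i) j t"
  with assms show "real (i * L + j) + t \<in> trace L T C"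
    unfolding trace_def by (simp only: mem_Collect_eq) blast
qed

lemma mem_trace_block:
  assumes "real k + t \<in> trace L T C" "0 \<le> t" "t < 1"
  shows "\<exists>i j. i \<le> T \<and> j < L \<and> k = i * L + j \<and> in_block (C i) j t"
proof -
  obtain i j t' where *: "real k + t = real (i * L + j) + t'" "i \<le> T" "j < L" "0 \<le> t'" "t' < 1"
    "in_block (C i) j t'" using assms(1) by (auto simp: trace_def simp del: of_nat_add of_nat_mult)
  with floor_decomposition_unique[OF *(1)] assms show ?thesis by blast
qed

text \<open>The rules apply to every real that looks like the left end of a block, so accidental
  blocks must be excluded. A full unit interval has a point whose fractional part exceeds all marks,
  which must lie in a starting interval. If its left end were not an integer, it would also reach
  into the following slot below all marks.\<close>

lemma start_trace:
  assumes "start (trace L T C) x" "L \<ge> 2"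
  shows "\<exists>i\<le>T. x = real (i * L)"
proof -
  have "x + 1 / 2 \<in> trace L T C" using assms by (auto simp: start_def)
  then have "x + 1 / 2 \<ge> 0" by (auto simp: trace_def)
  define k where "k = nat \<lfloor>x\<rfloor>"
  define t where "t = x - real k"
  have "x \<ge> 0"
  proof (rule ccontr)
    assume "\<not> x \<ge> 0"
    then have "x / 2 \<in> trace L T C" using assms \<open>x + 1 / 2 \<ge> 0\<close> by (auto simp: start_def)
    then have "x / 2 \<ge> 0" by (auto simp: trace_def)
    with \<open>\<not> x \<ge> 0\<close> show False by simp
  qed
  then have "real k = of_int \<lfloor>x\<rfloor>" unfolding k_def by simp
  then have t: "0 \<le> t" "t < 1" "x = real k + t" unfolding t_def by linarith+
  \<comment> \<open>A fractional part above both \<open>t\<close> and every mark.\<close>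
  define t1 where "t1 = (max t (3 / 4) + 1) / 2"
  have t1: "3 / 4 < t1" "t < t1" "t1 < 1" using t by (auto simp: t1_def max_def)
  have "real k + t1 \<in> trace L T C" using assms t t1 by (auto simp: start_def)
  then obtain i j where ij: "i \<le> T" "j < L" "k = i * L + j" "in_block (C i) j t1"
    using mem_trace_block[of k t1 L T C] t1 by auto
  have "t1 \<noteq> mark e" for e using t1 mark_bounds(2)[of e] by linarith
  then have "j = 0" using ij(4) t1 by (auto simp: in_block_def)
  have "t = 0"
  proof (rule ccontr)
    assume "t \<noteq> 0"
    \<comment> \<open>This point lies in the slot of register 0 with fractional part below 1/2,
      hence below all marks; \<open>L >= 2\<close> keeps that slot in the same block.\<close>
    have "real (Suc k) + t / 2 \<in> trace L T C" using assms t \<open>t \<noteq> 0\<close> by (auto simp: start_def)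
    moreover have "Suc k = i * L + 1" using ij \<open>j = 0\<close> by simp
    ultimately have "real (i * L + 1) + t / 2 \<in> trace L T C" by metis
    then have "in_block (C i) 1 (t / 2)"
      using mem_trace[of i T 1 L "t / 2" C] ij assms t by auto
    moreover have "t / 2 \<noteq> mark e" for e using t mark_bounds(1)[of e] by linarith
    ultimately show False using \<open>t \<noteq> 0\<close> by (auto simp: in_block_def)
  qed
  with ij t \<open>j = 0\<close> show ?thesis by auto
qed

lemma start_traceI:
  assumes "i \<le> T" "L > 0"
  shows "start (trace L T C) (real (i * L))"
  unfolding start_def
proof (intro allI impI)
  fix y assume y: "real (i * L) < y" "y < real (i * L) + 1"
  then have "real (i * L + 0) + (y - real (i * L)) \<in> trace L T C"
    by (subst mem_trace) (use assms in \<open>auto simp: in_block_def\<close>)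
  then show "y \<in> trace L T C" by simp
qed

lemma flag_trace:
  assumes "i \<le> T" "q < L"
  shows "real (i * L) + real q \<in> trace L T C \<longleftrightarrow> fst (C i) = q"
  using mem_trace[of i T q L 0 C] assms by (auto simp: in_block_def)

lemma slot_trace:
  assumes "i \<le> T" "Suc r < L" "y \<in> slot (real (i * L)) r"
  shows "y \<in> trace L T C \<longleftrightarrow> (\<exists>e<snd (C i) r. y = real (i * L) + real r + 1 + mark e)"
proof -
  define t where "t = y - real (i * L + Suc r)"
  have t: "0 < t" "t < 1" using assms(3) by (auto simp: slot_def t_def)
  have "y \<in> trace L T C \<longleftrightarrow> real (i * L + Suc r) + t \<in> trace L T C" by (simp add: t_def)
  also have "\<dots> \<longleftrightarrow> in_block (C i) (Suc r) t" by (rule mem_trace) (use assms t in auto)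
  also have "\<dots> \<longleftrightarrow> (\<exists>e<snd (C i) r. y = real (i * L) + real r + 1 + mark e)"
    using t by (auto simp: in_block_def t_def)
  finally show ?thesis .
qed

lemma mark_in_slot: "x + real r + 1 + mark e \<in> slot x r"
  using mark_bounds(3,4)[of e] by (simp add: slot_def)

lemma trace_slot_eq:
  assumes "i \<le> T" "Suc r < L"
  shows "trace L T C \<inter> slot (real (i * L)) r =
    (\<lambda>e. real (i * L) + real r + 1 + mark e) ` {..<snd (C i) r}"
  using slot_trace[OF assms] mark_in_slot by auto

lemma encodes_trace:
  assumes "i \<le> T" "fst (C i) < L" "R < L"
  shows "encodes (trace L T C) R (real (i * L)) (C i)"
proof -
  have "card ((\<lambda>e. real (i * L) + real r + 1 + mark e) ` {..<snd (C i) r}) = snd (C i) r" for r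
    by (subst card_image) (auto simp: inj_on_def mark_eq_iff)
  moreover have "trace L T C \<inter> slot (real (i * L)) r =
      (\<lambda>e. real (i * L) + real r + 1 + mark e) ` {..<snd (C i) r}" if "r < R" for r
    by (rule trace_slot_eq) (use assms that in auto)
  ultimately show ?thesis
    unfolding encodes_def using assms start_traceI[of i T L C] flag_trace[of i T "fst (C i)" L C]
    by (simp del: of_nat_mult)
qed

lemma carries_traceI:
  assumes "Suc i \<le> T" "Suc r < L"
    and "\<And>e. real (i * L) + real r + 1 + mark e \<in> Q \<longleftrightarrow> e < snd (C (Suc i)) r"
    and "\<And>y. y \<in> Q \<Longrightarrow> y \<in> slot (real (i * L)) r \<Longrightarrow> \<exists>e. y = real (i * L) + real r + 1 + mark e"
  shows "carries (trace L T C) L (real (i * L)) r Q"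
  unfolding carries_def
proof
  fix y assume y: "y \<in> slot (real (i * L)) r"
  then have "y + real L \<in> slot (real (Suc i * L)) r" by (auto simp: slot_def algebra_simps)
  from slot_trace[OF assms(1,2) this]
  have "y + real L \<in> trace L T C \<longleftrightarrow> (\<exists>e<snd (C (Suc i)) r. y = real (i * L) + real r + 1 + mark e)"
    by (auto simp: algebra_simps)
  then show "y + real L \<in> trace L T C \<longleftrightarrow> y \<in> Q" by (metis assms(3,4) y)
qed

lemma mark_mem_trace:
  assumes "i \<le> T" "Suc r < L"
  shows "real (i * L) + real r + 1 + mark e \<in> trace L T C \<longleftrightarrow> e < snd (C i) r"
  using slot_trace[OF assms mark_in_slot] by (auto simp: mark_eq_iff)

text \<open>A register with content \<open>n\<close> is represented by the marks 0 to
  \<open>n - 1\<close>. An increment adds mark \<open>n\<close> and a decrement removes mark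
  \<open>n - 1\<close>, so the next slot is again an initial segment of marks.\<close>

lemma obeys_trace:
  assumes C: "C (Suc i) = effect ins (snd (C i))" and "Suc i \<le> T" and L: "fst (C (Suc i)) < L" "R < L" "R > 0"
    and R: "case ins of Incr r k \<Rightarrow> r < R | Jzdec r k0 k1 \<Rightarrow> r < R"
  shows "obeys (trace L T C) L R (real (i * L)) ins"
proof -
  define P where "P = trace L T C"
  define x where "x = real (i * L)"
  have mark_mem: "x + real r + 1 + mark e \<in> P \<longleftrightarrow> e < snd (C i) r" if "r < R" for r e
    unfolding P_def x_def by (rule mark_mem_trace) (use that assms in auto)
  have mark_ex: "\<exists>e. y = x + real r + 1 + mark e" if "r < R" "y \<in> P" "y \<in> slot x r" for y r
    using slot_trace[of i T r L y C] that assms unfolding P_def x_def by auto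
  have carries: "carries P L x r Q"
    if "r < R" "\<And>e. x + real r + 1 + mark e \<in> Q \<longleftrightarrow> e < snd (C (Suc i)) r"
      "\<And>y. y \<in> Q \<Longrightarrow> y \<in> slot x r \<Longrightarrow> \<exists>e. y = x + real r + 1 + mark e" for r Q
  proof (unfold P_def x_def, rule carries_traceI, fold x_def)
    show "Suc i \<le> T" "Suc r < L" using assms(2) L \<open>r < R\<close> by simp_all
    show "x + real r + 1 + mark e \<in> Q \<longleftrightarrow> e < snd (C (Suc i)) r" for e by (rule that(2))
    show "\<exists>e. y = x + real r + 1 + mark e" if "y \<in> Q" "y \<in> slot x r" for y
      using that by (rule \<open>\<And>y. y \<in> Q \<Longrightarrow> y \<in> slot x r \<Longrightarrow> _\<close>)
  qed
  have next_block: "next_block P L R x (fst (C (Suc i))) rs"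
    if "\<And>r. r \<notin> set rs \<Longrightarrow> snd (C (Suc i)) r = snd (C i) r" for rs
    unfolding next_block_def
  proof (intro conjI allI impI)
    show "start P (x + real L)"
      using start_traceI[of "Suc i" T L C] assms by (simp add: algebra_simps P_def x_def)
    show "x + real L + real (fst (C (Suc i))) \<in> P"
      using flag_trace[of "Suc i" T "fst (C (Suc i))" L C] assms by (simp add: algebra_simps P_def x_def)
    show "carries P L x r P" if "r < R" "r \<notin> set rs" for r
    proof (rule carries[OF \<open>r < R\<close>])
      show "x + real r + 1 + mark e \<in> P \<longleftrightarrow> e < snd (C (Suc i)) r" for e
        using mark_mem[OF \<open>r < R\<close>] \<open>r \<notin> set rs\<close> \<open>\<And>r. r \<notin> set rs \<Longrightarrow> _\<close> by simp
    qed (rule mark_ex[OF \<open>r < R\<close>])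
  qed
  have "obeys P L R x ins"
  proof (cases ins)
    case (Incr r k)
    let ?w = "x + real r + 1 + mark (snd (C i) r)"
    have "r < R" using R Incr by simp
    have n: "snd (C (Suc i)) r = Suc (snd (C i) r)" unfolding C Incr by simp
    have "carries P L x r (insert ?w P)"
    proof (rule carries[OF \<open>r < R\<close>])
      show "x + real r + 1 + mark e \<in> insert ?w P \<longleftrightarrow> e < snd (C (Suc i)) r" for e
        unfolding n insert_iff mark_mem[OF \<open>r < R\<close>] by (auto simp: mark_eq_iff)
      show "\<exists>e. y = x + real r + 1 + mark e" if "y \<in> insert ?w P" "y \<in> slot x r" for y
        using that mark_ex[OF \<open>r < R\<close> _ that(2)] by (elim insertE) blast+
    qed
    moreover have "?w \<notin> P" using mark_mem[OF \<open>r < R\<close>] by simp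
    moreover have "next_block P L R x k [r]" using next_block[of "[r]"] C Incr by simp
    ultimately show ?thesis using Incr mark_in_slot[of x r] by auto
  next
    case (Jzdec r k0 k1)
    have "r < R" using R Jzdec by simp
    show ?thesis
    proof (cases "snd (C i) r = 0")
      case True
      then have "slot x r \<inter> P = {}" using mark_mem[OF \<open>r < R\<close>] mark_ex[OF \<open>r < R\<close>] by (metis disjoint_iff not_less_zero)
      moreover have "next_block P L R x k0 []" using next_block[of "[]"] C Jzdec True by simp
      ultimately show ?thesis using Jzdec by simp
    next
      case False
      let ?w = "x + real r + 1 + mark (snd (C i) r - 1)"
      have n: "snd (C (Suc i)) r = snd (C i) r - 1" unfolding C Jzdec using False by simp
      have "carries P L x r (P - {?w})"
      proof (rule carries[OF \<open>r < R\<close>])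
        show "x + real r + 1 + mark e \<in> P - {?w} \<longleftrightarrow> e < snd (C (Suc i)) r" for e
          unfolding n Diff_iff mark_mem[OF \<open>r < R\<close>] using False by (auto simp: mark_eq_iff)
        show "\<exists>e. y = x + real r + 1 + mark e" if "y \<in> P - {?w}" "y \<in> slot x r" for y
          using that by (intro mark_ex[OF \<open>r < R\<close>]) auto
      qed
      moreover have "?w \<in> P" using mark_mem[OF \<open>r < R\<close>] False by simp
      moreover have "next_block P L R x k1 [r]" using next_block[of "[r]"] C Jzdec False by simp
      ultimately show ?thesis using Jzdec mark_in_slot[of x r] by auto
    qed
  qed
  then show ?thesis by (simp only: P_def x_def)
qed

section \<open>The input register\<close>

text \<open>
  Prefixing a formula with \<open>m\<close> copies of \<open>chain_fm\<close> moves variable 0 down past \<open>m\<close> elements of the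
  predicate, without leaving the slot of register 0. Unlike a difference constraint with a
  constant proportional to \<open>m\<close>, this does not depend on the block length, which in turn depends on the
  machine.
\<close>

definition no_input_fm :: fm where
  "no_input_fm = Forall 1 (Impl (Conj (Diff GT 1 4 1) (Order LT 1 0)) (Neg (Pred 0 1)))"

definition previous_fm :: fm where
  "previous_fm = Conj (Conj (Diff GT 1 4 1) (Order LT 1 0)) (Conj (Pred 0 1)
     (Forall 2 (Impl (Conj (Order LT 1 2) (Order LT 2 0)) (Neg (Pred 0 2)))))"

text \<open>Variable 0 is bound again and set to variable 1, so each copy is the same piece of
  syntax. The code of a prefixed formula thus arises by iterating one fixed function.\<close>

definition chain_fm :: "fm \<Rightarrow> fm" where
  "chain_fm A = Exists 1 (Conj previous_fm (Exists 0 (Conj (Order EQ 0 1) A)))"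

text \<open>The descent starts at the right end of the slot of register 0.\<close>

definition input_fm :: "nat \<Rightarrow> fm \<Rightarrow> fm" where
  "input_fm m A = Conj (Diff EQ 0 4 2) ((chain_fm ^^ m) A)"

text \<open>Each copy strips off the greatest element below variable 0, and
  \<open>no_input_fm\<close> checks that none is left. Variables 0 and 1 are overwritten on the way,
  hence the assumption that \<open>B\<close> depends on variable 4 only.\<close>

lemma holds_chain:
  assumes "\<And>v. holds I v B \<longleftrightarrow> Q (v 4)"
  shows "holds I v ((chain_fm ^^ m) (Conj no_input_fm B)) \<longleftrightarrow>
    finite (I 0 \<inter> {v 4 + 1<..<v 0}) \<and> card (I 0 \<inter> {v 4 + 1<..<v 0}) = m \<and> Q (v 4)"
proof (induction m arbitrary: v)
  case 0
  have "holds I v no_input_fm \<longleftrightarrow> I 0 \<inter> {v 4 + 1<..<v 0} = {}"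
    by (auto simp: no_input_fm_def algebra_simps)
  moreover have "finite S \<and> card S = 0 \<longleftrightarrow> S = {}" for S :: "real set"
    by auto
  ultimately show ?case
    using assms by (simp only: funpow_0 holds.simps conj_assoc[symmetric])
next
  case (Suc m)
  define S where "S a = I 0 \<inter> {v 4 + 1<..<a}" for a
  have "holds I v ((chain_fm ^^ Suc m) (Conj no_input_fm B)) \<longleftrightarrow>
    (\<exists>a. a \<in> S (v 0) \<and> (\<forall>b. a < b \<and> b < v 0 \<longrightarrow> b \<notin> I 0) \<and> finite (S a) \<and> card (S a) = m \<and> Q (v 4))"
    by (auto simp: chain_fm_def previous_fm_def Suc.IH S_def algebra_simps)
  also have "\<dots> \<longleftrightarrow> finite (S (v 0)) \<and> card (S (v 0)) = Suc m \<and> Q (v 4)"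
  proof (intro iffI)
    assume "\<exists>a. a \<in> S (v 0) \<and> (\<forall>b. a < b \<and> b < v 0 \<longrightarrow> b \<notin> I 0) \<and> finite (S a) \<and> card (S a) = m \<and> Q (v 4)"
    then obtain a where a: "a \<in> S (v 0)" "\<forall>b. a < b \<and> b < v 0 \<longrightarrow> b \<notin> I 0" "finite (S a)" "card (S a) = m" "Q (v 4)"
      by blast
    have "b \<in> S (v 0) \<longleftrightarrow> b \<in> insert a (S a)" for b
      using a(1,2) by (cases b a rule: linorder_cases) (auto simp: S_def)
    then have "S (v 0) = insert a (S a)" by blast
    moreover have "a \<notin> S a" by (simp add: S_def)
    ultimately show "finite (S (v 0)) \<and> card (S (v 0)) = Suc m \<and> Q (v 4)" using a by simp
  next
    assume *: "finite (S (v 0)) \<and> card (S (v 0)) = Suc m \<and> Q (v 4)"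
    define a where "a = Max (S (v 0))"
    have "S (v 0) \<noteq> {}" using * by auto
    then have a: "a \<in> S (v 0)" "\<And>b. b \<in> S (v 0) \<Longrightarrow> b \<le> a" using * by (auto simp: a_def)
    then have "S a = S (v 0) - {a}" by (fastforce simp: S_def)
    moreover have "b \<notin> I 0" if "a < b" "b < v 0" for b
      using a(2)[of b] a(1) that by (auto simp: S_def)
    ultimately show "\<exists>a. a \<in> S (v 0) \<and> (\<forall>b. a < b \<and> b < v 0 \<longrightarrow> b \<notin> I 0) \<and> finite (S a) \<and> card (S a) = m \<and> Q (v 4)"
      using * a(1) by (intro exI[of _ a]) simp
  qed
  finally show ?case by (simp add: S_def)
qed

lemma satisfiable_input:
  assumes "\<And>I v. holds I v B \<longleftrightarrow> Q (I 0) (v 4)"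
  shows "satisfiable (input_fm m (Conj no_input_fm B)) \<longleftrightarrow>
    (\<exists>P x. finite (P \<inter> slot x 0) \<and> card (P \<inter> slot x 0) = m \<and> Q P x)"
proof -
  have *: "holds I v (input_fm m (Conj no_input_fm B)) \<longleftrightarrow> v 0 = v 4 + 2 \<and>
    finite (I 0 \<inter> slot (v 4) 0) \<and> card (I 0 \<inter> slot (v 4) 0) = m \<and> Q (I 0) (v 4)" for I v
    using holds_chain[where I = I and B = B and Q = "Q (I 0)"] assms
    by (auto simp: input_fm_def slot_def algebra_simps)
  show ?thesis
  proof
    assume "\<exists>P x. finite (P \<inter> slot x 0) \<and> card (P \<inter> slot x 0) = m \<and> Q P x"
    then obtain P x where "finite (P \<inter> slot x 0)" "card (P \<inter> slot x 0) = m" "Q P x" by blast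
    then have "holds (\<lambda>p. P) ((\<lambda>i. x)(0 := x + 2)) (input_fm m (Conj no_input_fm B))"
      unfolding * by simp
    then show "satisfiable (input_fm m (Conj no_input_fm B))" unfolding satisfiable_def by blast
  qed (use * in \<open>auto simp: satisfiable_def\<close>)
qed

lemma pred_symbols_input: "pred_symbols A = {0} \<Longrightarrow> pred_symbols (input_fm m A) = {0}"
proof -
  assume "pred_symbols A = {0}"
  then have "pred_symbols ((chain_fm ^^ m) A) = {0}"
    by (induction m) (auto simp: chain_fm_def previous_fm_def)
  then show ?thesis by (simp add: input_fm_def)
qed

text \<open>8 and 4 are the tags of \<open>Exists\<close> and \<open>Conj\<close>. The given code is
  only wrapped and never decoded, so computability follows from that of
  \<open>prod_encode\<close>.\<close>

definition chain_code :: "nat \<Rightarrow> nat" where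
  "chain_code n = prod_encode (8, prod_encode (1, prod_encode (4, prod_encode (fm_code previous_fm,
     prod_encode (8, prod_encode (0, prod_encode (4, prod_encode (fm_code (Order EQ 0 1), n))))))))"

lemma fm_code_input:
  "fm_code (input_fm m A) =
     prod_encode (4, prod_encode (fm_code (Diff EQ 0 4 2), (chain_code ^^ m) (fm_code A)))"
proof -
  have "fm_code ((chain_fm ^^ m) A) = (chain_code ^^ m) (fm_code A)"
    by (induction m) (simp_all add: chain_fm_def chain_code_def)
  then show ?thesis by (simp add: input_fm_def)
qed

section \<open>Formulas describing computations\<close>

text \<open>Register 0 is left open because the input prefix fixes it. The last conjunct forbids a
  nonzero output in register 1 at the exit label \<open>e\<close>.\<close>

definition rules_fm :: "nat \<Rightarrow> nat \<Rightarrow> nat \<Rightarrow> (nat \<times> instr) list \<Rightarrow> fm" where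
  "rules_fm L R e ps = Conj
     (Conj (start_fm 0) (Conj (flag_fm 0) (conj_list (map empty_fm [1..<R]))))
     (Conj (conj_list (map (\<lambda>(q, i). at_label_fm q (instr_fm L R i)) ps))
       (at_label_fm e (empty_fm 1)))"

definition obeys_rules :: "nat \<Rightarrow> nat \<Rightarrow> nat \<Rightarrow> (nat \<times> instr) set \<Rightarrow> real set \<Rightarrow> real \<Rightarrow> bool" where
  "obeys_rules L R e p P x \<longleftrightarrow>
     start P x \<and> x \<in> P \<and> (\<forall>r. 1 \<le> r \<and> r < R \<longrightarrow> slot x r \<inter> P = {}) \<and>
     follows P L R p \<and> (\<forall>y. start P y \<longrightarrow> y + real e \<in> P \<longrightarrow> slot y 1 \<inter> P = {})"

lemma holds_rules: "holds I v (rules_fm L R e ps) \<longleftrightarrow> obeys_rules L R e (set ps) (I 0) (v 4)"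
  by (auto simp: rules_fm_def obeys_rules_def follows_def holds_start holds_flag holds_empty
      holds_conj_list holds_at_label holds_instr)

lemma pred_symbols_rules: "pred_symbols (rules_fm L R e ps) = {0}"
  by (auto simp: rules_fm_def fm_defs pred_symbols_conj_list pred_symbols_instr)

lemma ex_registers_below: "finite p \<Longrightarrow> \<exists>R\<ge>2. registers_below R p"
proof (induction rule: finite_induct)
  case empty
  show ?case by (auto simp: registers_below_def)
next
  case (insert x p)
  then obtain R where R: "R \<ge> 2" "registers_below R p" by blast
  obtain q i where x: "x = (q, i)" by fastforce
  define r where "r = (case i of Incr r k \<Rightarrow> r | Jzdec r k0 k1 \<Rightarrow> r)"
  have "registers_below (R + Suc r) (insert x p)"
    using R(2) by (fastforce simp: registers_below_def x r_def split: instr.splits)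
  with R(1) show ?case by (intro exI[of _ "R + Suc r"]) simp
qed

text \<open>The trace breaks off after the last block of the halting run. That block is at the exit
  label \<open>e\<close>, where by \<open>lab\<close> no instruction demands a successor; by
  \<open>det\<close> an earlier block need only obey the instruction executed there.\<close>

lemma ex_trace:
  assumes "(step p)\<^sup>*\<^sup>* (0, s) (e, t)"
    and det: "\<And>q i j. (q, i) \<in> p \<Longrightarrow> (q, j) \<in> p \<Longrightarrow> i = j"
    and lab: "\<And>q i. (q, i) \<in> p \<Longrightarrow> q < e"
    and R: "registers_below R p" "R \<ge> 2" and L: "R < L" "e < L"
    and s: "\<And>r. r \<ge> 1 \<Longrightarrow> s r = 0" and t: "t 1 = 0"
  shows "\<exists>P x. finite (P \<inter> slot x 0) \<and> card (P \<inter> slot x 0) = s 0 \<and> obeys_rules L R e p P x"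
proof -
  obtain T where "(step p ^^ T) (0, s) (e, t)"
    using assms(1) by (auto simp: rtranclp_power)
  then obtain C where C: "C 0 = (0, s)" "C T = (e, t)" "\<And>i. i < T \<Longrightarrow> step p (C i) (C (Suc i))"
    by (auto simp: relpowp_fun_conv)
  define P where "P = trace L T C"
  have before: "fst (C i) < e" if "i < T" for i
    using C(3)[OF that] lab by (auto simp: step_def)
  then have label: "fst (C i) < L" if "i \<le> T" for i
    using that C(2) L by (cases "i = T") (auto simp: le_less intro: less_trans)
  have enc: "encodes P R (real (i * L)) (C i)" if "i \<le> T" for i
    unfolding P_def by (rule encodes_trace) (use that label L in auto)
  have at_label: "\<exists>i\<le>T. x = real (i * L) \<and> fst (C i) = q"
    if x: "start P x" "x + real q \<in> P" and "q < L" for x q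
  proof -
    obtain i where i: "i \<le> T" "x = real (i * L)"
      using start_trace[of L T C x] x R L unfolding P_def by auto
    moreover have "fst (C i) = q"
      using flag_trace[of i T q L C] x \<open>q < L\<close> i unfolding P_def by blast
    ultimately show ?thesis by blast
  qed
  have slot_empty: "slot (real (i * L)) r \<inter> P = {}" if "i \<le> T" "r < R" "snd (C i) r = 0" for i r
  proof -
    have "finite (P \<inter> slot (real (i * L)) r)" "card (P \<inter> slot (real (i * L)) r) = 0"
      using enc[OF that(1)] that(2,3) by (simp_all add: encodes_def)
    then show ?thesis by (metis Int_commute card_0_eq)
  qed
  have "obeys P L R x i" if qi: "(q, i) \<in> p" and x: "start P x" "x + real q \<in> P" for q i x
  proof -
    have "q < e" using qi lab by blast
    then obtain k where k: "k \<le> T" "x = real (k * L)" "fst (C k) = q"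
      using at_label[OF x] L by auto
    then have "k < T" using \<open>q < e\<close> C(2) by (cases "k = T") auto
    then obtain j where "(q, j) \<in> p" "C (Suc k) = effect j (snd (C k))"
      using C(3) k(3) by (auto simp: step_def)
    then have eff: "C (Suc k) = effect i (snd (C k))" using det qi by blast
    show "obeys P L R x i"
      unfolding P_def k(2)
    proof (rule obeys_trace[OF eff])
      show "case i of Incr r k \<Rightarrow> r < R | Jzdec r k0 k1 \<Rightarrow> r < R"
        using R(1) qi by (fastforce simp: registers_below_def)
    qed (use \<open>k < T\<close> label L R in auto)
  qed
  then have "follows P L R p" by (auto simp: follows_def)
  moreover have "slot y 1 \<inter> P = {}" if y: "start P y" "y + real e \<in> P" for y
  proof -
    obtain i where i: "i \<le> T" "y = real (i * L)" "fst (C i) = e"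
      using at_label[OF y L(2)] by blast
    then have "i = T" using before[of i] by (cases "i = T") auto
    then have "snd (C i) 1 = 0" using C(2) t by simp
    then show ?thesis using slot_empty[of i 1] i R by simp
  qed
  moreover have "slot 0 r \<inter> P = {}" if "1 \<le> r" "r < R" for r
    using slot_empty[of 0 r] that C(1) s by simp
  moreover have "encodes P R 0 (0, s)" using enc[of 0] C(1) by simp
  ultimately show ?thesis
    using R by (intro exI[of _ P] exI[of _ 0]) (auto simp: obeys_rules_def encodes_def)
qed

text \<open>\<open>B\<close> depends on \<open>f\<close> but not on \<open>m\<close>, so that
  \<open>m\<close> can later be the code of a formula containing \<open>B\<close>. Nothing is
  claimed where \<open>f\<close> diverges or has another value.\<close>

lemma ex_computation_fm:
  "\<exists>B. pred_symbols B = {0} \<and>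
     (\<forall>m. (computes f [m] 0 \<longrightarrow> satisfiable (input_fm m (Conj no_input_fm B))) \<and>
          (computes f [m] 1 \<longrightarrow> \<not> satisfiable (input_fm m (Conj no_input_fm B))))"
proof -
  obtain c where c: "implements f [0] 1 2 c" using ex_implements[of "[0]" 2 1 f] by auto
  define e where "e = com_size c"
  define p where "p = flat c 0 e"
  obtain ps where ps: "set ps = p" using finite_list[OF finite_flat] unfolding p_def by blast
  obtain R where R: "R \<ge> 2" "registers_below R p"
    using ex_registers_below[OF finite_flat] unfolding p_def by blast
  \<comment> \<open>A block must hold the flags at offsets 0 to \<open>e\<close> and the register
    slots at offsets 1 to \<open>R\<close>.\<close>
  define L where "L = R + e + 1"
  define s where "s m = (\<lambda>r. 0 :: nat)((0 :: nat) := m)" for m :: nat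
  have run: "(step p)\<^sup>*\<^sup>* (0, s m) (e, (s m)(1 := y))" if "computes f [m] y" for m y
  proof (rule exec_steps)
    show "exec c (s m) ((s m)(1 := y))"
      by (rule implementsD[OF c _ _ _ that]) (auto simp: s_def)
  qed (simp add: p_def)
  let ?B = "rules_fm L R e ps"
  have sat: "satisfiable (input_fm m (Conj no_input_fm ?B)) \<longleftrightarrow>
    (\<exists>P x. finite (P \<inter> slot x 0) \<and> card (P \<inter> slot x 0) = m \<and> obeys_rules L R e p P x)" for m
    using satisfiable_input[of ?B "obeys_rules L R e p"] holds_rules ps by simp
  have "satisfiable (input_fm m (Conj no_input_fm ?B))" if "computes f [m] 0" for m
  proof -
    have "\<exists>P x. finite (P \<inter> slot x 0) \<and> card (P \<inter> slot x 0) = s m 0 \<and> obeys_rules L R e p P x"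
    proof (rule ex_trace[OF run[OF that] _ _ R(2,1)])
      show "i = j" if "(q, i) \<in> p" "(q, j) \<in> p" for q i j
        using that flat_deterministic unfolding p_def by blast
      show "q < e" if "(q, i) \<in> p" for q i
        using that flat_label[of q i c 0 e] unfolding p_def e_def by simp
    qed (auto simp: L_def s_def)
    then show ?thesis unfolding sat by (simp add: s_def)
  qed
  moreover have "\<not> satisfiable (input_fm m (Conj no_input_fm ?B))" if "computes f [m] 1" for m
  proof
    assume "satisfiable (input_fm m (Conj no_input_fm ?B))"
    then obtain P x where P: "finite (P \<inter> slot x 0)" "card (P \<inter> slot x 0) = m" "obeys_rules L R e p P x"
      unfolding sat by blast
    have "finite (P \<inter> slot x r) \<and> card (P \<inter> slot x r) = s m r" if "r < R" for r
      using P that by (cases "r = 0") (auto simp: obeys_rules_def s_def Int_commute)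
    then have "encodes P R x (0, s m)" using P(3) by (simp add: encodes_def obeys_rules_def)
    \<comment> \<open>Output 1 forces a point into the slot of register 1 at the exit label, where
      the rules demand an empty slot.\<close>
    from follows_steps[OF _ R(2) this run[OF that]] obtain y where "encodes P R y (e, (s m)(1 := 1))"
      using P(3) unfolding obeys_rules_def by blast
    then have "start P y" "y + real e \<in> P" "card (P \<inter> slot y 1) = 1"
      using R(1) by (auto simp: encodes_def)
    moreover from this have "P \<inter> slot y 1 = {}" using P(3) by (auto simp: obeys_rules_def)
    ultimately show False by simp
  qed
  ultimately show ?thesis using pred_symbols_rules by blast
qed

section \<open>Diagonalisation\<close>

theorem theorem2:
  "\<not> decidable_on fm_code {A. card (pred_symbols A) = 1} satisfiable"
proof
  assume "decidable_on fm_code {A. card (pred_symbols A) = 1} satisfiable"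
  then obtain f where f: "\<And>A. card (pred_symbols A) = 1 \<Longrightarrow> computes f [fm_code A] (if satisfiable A then 1 else 0)"
    unfolding decidable_on_def by auto
  have "computable chain_code"
    unfolding chain_code_def by (intro computable_prod_encode computable_const computable_id)
  \<comment> \<open>At the code \<open>x\<close> of a formula \<open>A\<close> this is the code of
    \<open>input_fm x A\<close>.\<close>
  then have "computable (\<lambda>x. prod_encode (4, prod_encode (fm_code (Diff EQ 0 4 2), (chain_code ^^ x) x)))"
    by (intro computable_prod_encode computable_const computable_diagonal_iterate)
  then obtain d where d: "\<And>x. computes d [x]
      (prod_encode (4, prod_encode (fm_code (Diff EQ 0 4 2), (chain_code ^^ x) x)))"
    unfolding computable_def by blast
  obtain B where B: "pred_symbols B = {0}"
    "\<And>m. computes (Comp f [d]) [m] 0 \<Longrightarrow> satisfiable (input_fm m (Conj no_input_fm B))"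
    "\<And>m. computes (Comp f [d]) [m] 1 \<Longrightarrow> \<not> satisfiable (input_fm m (Conj no_input_fm B))"
    using ex_computation_fm[of "Comp f [d]"] by blast
  define A where "A = Conj no_input_fm B"
  define m where "m = fm_code A"
  have "computes d [m] (fm_code (input_fm m A))"
    using d[of m] by (simp only: fm_code_input m_def)
  moreover have "pred_symbols (input_fm m A) = {0}"
    by (rule pred_symbols_input) (use B(1) in \<open>auto simp: A_def no_input_fm_def\<close>)
  then have "computes f [fm_code (input_fm m A)] (if satisfiable (input_fm m A) then 1 else 0)"
    by (intro f) simp
  ultimately have "computes (Comp f [d]) [m] (if satisfiable (input_fm m A) then 1 else 0)"
    by (rule computes_Comp1)
  \<comment> \<open>By the choice of \<open>B\<close>, verdict 1 on \<open>input_fm m A\<close>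
    makes this formula unsatisfiable and verdict 0 makes it satisfiable, contrary to the correctness
    of \<open>f\<close>.\<close>
  then show False using B(2,3)[of m] unfolding A_def by (auto split: if_splits)
qed

end
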